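(* Let $m\ge3$ and $1\le\ell\le\lfloor\frac{m-1}{2}\rfloor$ be integers, $\kappa\in\mathbb{R}$, $\lambda_1=\frac{m-\ell}{m}$, $\lambda_2=\frac{\ell}{m}$. For every $n\ge1$ the polynomials $p_n^{(1)},\sigma_0p_n^{(1)},p_n^{(2)},\sigma_0p_n^{(2)}$ form a basis of the space of harmonic homogeneous polynomials of degree $n$ in $\mathcal{P}_{m,\ell}$, and: (a) $\mathrm{span}\{p_n^{(1)},\sigma_0p_n^{(1)}\}$ is orthogonal to $\mathrm{span}\{p_n^{(2)},\sigma_0p_n^{(2)}\}$ with respect to $\langle\cdot,\cdot\rangle$. (b) If $n+\ell\not\equiv0\pmod m$ then $\langle p_n^{(1)},\sigma_0p_n^{(1)}\rangle=0$; if $n-\ell\not\equiv0\pmod m$ then $\langle p_n^{(2)},\sigma_0p_n^{(2)}\rangle=0$. (c) Let $k\ge-1$ be an integer, and let either $j=1$ and $n=m(k+2)-\ell$, or $j=2$ and $n=m(k+1)+\ell$. Then $\langle p_n^{(j)}+\sigma_0p_n^{(j)},\,p_n^{(j)}-\sigma_0p_n^{(j)}\rangle=0$ and $$\langle p_n^{(j)}+\sigma_0p_n^{(j)},p_n^{(j)}+\sigma_0p_n^{(j)}\rangle=2^{n+2}n!\,\frac{(\lambda_j-\kappa)_{k+2}(\lambda_j+\kappa)_{k+1}}{(\lambda_j)_{k+2}(\lambda_j)_{k+1}},$$ $$\langle p_n^{(j)}-\sigma_0p_n^{(j)},p_n^{(j)}-\sigma_0p_n^{(j)}\rangle=2^{n+2}n!\,\frac{(\lambda_j-\kappa)_{k+1}(\lambda_j+\kappa)_{k+2}}{(\lambda_j)_{k+1}(\lambda_j)_{k+2}}.$$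 Also, for $f_n^{(j)}:=p_n^{(j)}+\frac{m\kappa}{n}\sigma_0p_n^{(j)}$ one has $\langle\sigma_0p_n^{(j)},f_n^{(j)}\rangle=0$ and $$\langle f_n^{(j)},f_n^{(j)}\rangle=2^{n+1}n!\,\frac{(\lambda_j-\kappa)_{k+2}(\lambda_j+\kappa)_{k+2}}{(\lambda_j)_{k+2}^2}.$$
   Context: Set $\omega=e^{2\pi\mathrm{i}/m}$; $(a)_i=a(a+1)\cdots(a+i-1)$, $(a)_0=1$. $\mathcal{P}_{m,\ell}$ is the complex vector space of polynomials $f(z,\overline z,t,\overline t)=f_1(z,\overline z)t+f_2(z,\overline z)\overline t$ with $f_1,f_2\in\mathbb{C}[z,\overline z]$; degree and homogeneity refer to $z,\overline z$. $\sigma_0$ acts by $\sigma_0f(z,\overline z,t,\overline t)=f(\overline z,z,\overline t,t)$. Dunkl operators on $\mathcal{P}_{m,\ell}$: $$\mathcal{D}f=\frac{\partial f}{\partial z}+\kappa\sum_{j=0}^{m-1}\frac{f(z,\overline z,\omega^{\ell j}\overline t,\omega^{-\ell j}t)-f(\overline z\omega^j,z\omega^{-j},\omega^{\ell j}\overline t,\omega^{-\ell j}t)}{z-\overline z\omega^j},$$ $$\overline{\mathcal{D}}f=\frac{\partial f}{\partial\overline z}-\kappa\sum_{j=0}^{m-1}\frac{f(z,\overline z,\omega^{\ell j}\overline t,\omega^{-\ell j}t)-f(\overline z\omega^j,z\omega^{-j},\omega^{\ell j}\overline t,\omega^{-\ell j}t)}{z-\overline z\omega^j}\,\omega^j.$$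 They commute; $f$ is harmonic if $\mathcal{D}\overline{\mathcal{D}}f=0$. For $p=\sum a_{jk}z^j\overline z^k$ let $p^*(2\overline{\mathcal D},2\mathcal D)=\sum\overline{a_{jk}}\,2^{j+k}\mathcal{D}^j\overline{\mathcal{D}}^k$. The form $\langle\cdot,\cdot\rangle$ on $\mathcal{P}_{m,\ell}$ is conjugate-linear in the first and linear in the second variable, with $\langle t,t\rangle=\langle\overline t,\overline t\rangle=2$, $\langle t,\overline t\rangle=\langle\overline t,t\rangle=0$, and $$\langle p_1t+p_2\overline t,q\rangle=\langle t,p_1^*(2\overline{\mathcal D},2\mathcal D)q\rangle|_{z=0}+\langle\overline t,p_2^*(2\overline{\mathcal D},2\mathcal D)q\rangle|_{z=0}.$$ The polynomials $p_n^{(1)},p_n^{(2)}$ $(n\ge1)$ are defined by $p_1^{(1)}=zt$, $p_1^{(2)}=z\overline t$, and for $n\ge1$: $p_{n+1}^{(1)}=zp_n^{(1)}$ if $n+\ell\not\equiv0\pmod m$, and $p_{n+1}^{(1)}=z\big(p_n^{(1)}+\frac{m\kappa}{n}\sigma_0p_n^{(1)}\big)$ if $n+\ell\equiv0\pmod m$; $p_{n+1}^{(2)}=zp_n^{(2)}$ if $n-\ell\not\equiv0\pmod m$, and $p_{n+1}^{(2)}=z\big(p_n^{(2)}+\frac{m\kappa}{n}\sigma_0p_n^{(2)}\big)$ if $n-\ell\equiv0\pmod m$. *)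

theory Defs
  imports
    "HOL-Analysis.Analysis"
    "HOL-Computational_Algebra.Computational_Algebra"
    "HOL-Number_Theory.Cong"
begin

text \<open>
  A polynomial in the independent variables \<open>z\<close>, \<open>z'\<close> (the latter standing for the conjugate
  variable) is an element of \<^typ>\<open>complex poly poly\<close>: the outer variable is \<open>z\<close> and the inner one
  is \<open>z'\<close>, so the coefficient of \<open>z^a z'^b\<close> in \<open>p\<close> is \<open>coeff (coeff p a) b\<close>.
  A pair \<open>(f1, f2)\<close> stands for the element \<open>f1 t + f2 t'\<close> of the space \<open>P_{m,l}\<close>.
\<close>

type_synonym bpoly = "complex poly poly"
type_synonym pspace = "bpoly \<times> bpoly"

definition const :: "complex \<Rightarrow> bpoly" where "const c = [:[:c:]:]"
definition zv :: bpoly where "zv = [:0, 1:]"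
definition zbv :: bpoly where "zbv = [:[:0, 1:]:]"

definition tv :: pspace where "tv = (1, 0)"
definition tbv :: pspace where "tbv = (0, 1)"

definition pmul :: "bpoly \<Rightarrow> pspace \<Rightarrow> pspace" where
  "pmul g f = (g * fst f, g * snd f)"

definition pscale :: "complex \<Rightarrow> pspace \<Rightarrow> pspace" where
  "pscale c f = pmul (const c) f"

lemma const_simps [simp]:
  "const 0 = 0" "const 1 = 1"
  "const (a + b) = const a + const b" "const (a * b) = const a * const b"
  by (simp_all add: const_def one_pCons)

interpretation pspace: vector_space pscale
  by unfold_locales (simp_all add: pscale_def pmul_def prod_eq_iff algebra_simps)

definition bsubst :: "bpoly \<Rightarrow> bpoly \<Rightarrow> bpoly \<Rightarrow> bpoly" where
  "bsubst p x y = poly (map_poly (\<lambda>q. poly (map_poly const q) y) p) x"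

text \<open>\<open>psubst f x y s u\<close> is \<open>f(x, y, s, u)\<close>, with linear forms \<open>s\<close>, \<open>u\<close> in \<open>t\<close>, \<open>t'\<close>.\<close>

definition psubst :: "pspace \<Rightarrow> bpoly \<Rightarrow> bpoly \<Rightarrow> pspace \<Rightarrow> pspace \<Rightarrow> pspace" where
  "psubst f x y s u = pmul (bsubst (fst f) x y) s + pmul (bsubst (snd f) x y) u"

definition sigma0 :: "pspace \<Rightarrow> pspace" where
  "sigma0 f = psubst f zbv zv tbv tv"

definition omega :: "nat \<Rightarrow> complex" where
  "omega m = exp (2 * of_real pi * \<i> / of_nat m)"

definition dz :: "pspace \<Rightarrow> pspace" where
  "dz f = (pderiv (fst f), pderiv (snd f))"

definition dzb :: "pspace \<Rightarrow> pspace" where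
  "dzb f = (map_poly pderiv (fst f), map_poly pderiv (snd f))"

definition numer :: "nat \<Rightarrow> nat \<Rightarrow> nat \<Rightarrow> pspace \<Rightarrow> pspace" where
  "numer m l j f =
     (let s = pscale (omega m powi (int l * int j)) tbv;
          u = pscale (omega m powi (- (int l * int j))) tv
      in psubst f zv zbv s u
         - psubst f (const (omega m powi int j) * zbv) (const (omega m powi (- int j)) * zv) s u)"

definition denom :: "nat \<Rightarrow> nat \<Rightarrow> bpoly" where
  "denom m j = zv - const (omega m ^ j) * zbv"

text \<open>The division is always exact; see \<open>denom_dvd_numer\<close> below.\<close>

definition dquot :: "nat \<Rightarrow> nat \<Rightarrow> nat \<Rightarrow> pspace \<Rightarrow> pspace" where
  "dquot m l j f = (fst (numer m l j f) div denom m j, snd (numer m l j f) div denom m j)"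

definition dunkl :: "nat \<Rightarrow> nat \<Rightarrow> real \<Rightarrow> pspace \<Rightarrow> pspace" where
  "dunkl m l \<kappa> f = dz f + pscale (of_real \<kappa>) (\<Sum>j<m. dquot m l j f)"

definition dunklb :: "nat \<Rightarrow> nat \<Rightarrow> real \<Rightarrow> pspace \<Rightarrow> pspace" where
  "dunklb m l \<kappa> f =
     dzb f - pscale (of_real \<kappa>) (\<Sum>j<m. pscale (omega m ^ j) (dquot m l j f))"

definition harmonic :: "nat \<Rightarrow> nat \<Rightarrow> real \<Rightarrow> pspace \<Rightarrow> bool" where
  "harmonic m l \<kappa> f \<longleftrightarrow> dunkl m l \<kappa> (dunklb m l \<kappa> f) = 0"

definition bhomogeneous :: "nat \<Rightarrow> bpoly \<Rightarrow> bool" where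
  "bhomogeneous n p \<longleftrightarrow> (\<forall>a b. coeff (coeff p a) b \<noteq> 0 \<longrightarrow> a + b = n)"

definition homogeneous :: "nat \<Rightarrow> pspace \<Rightarrow> bool" where
  "homogeneous n f \<longleftrightarrow> bhomogeneous n (fst f) \<and> bhomogeneous n (snd f)"

definition harmonics :: "nat \<Rightarrow> nat \<Rightarrow> real \<Rightarrow> nat \<Rightarrow> pspace set" where
  "harmonics m l \<kappa> n = {f. homogeneous n f \<and> harmonic m l \<kappa> f}"

text \<open>\<open>star_op m l \<kappa> p\<close> is the operator \<open>p*(2 D', 2 D)\<close>.\<close>

definition star_op :: "nat \<Rightarrow> nat \<Rightarrow> real \<Rightarrow> bpoly \<Rightarrow> pspace \<Rightarrow> pspace" where
  "star_op m l \<kappa> p q =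
     (\<Sum>a\<le>degree p. \<Sum>b\<le>degree (coeff p a).
        pscale (cnj (coeff (coeff p a) b) * 2 ^ (a + b))
          ((dunkl m l \<kappa> ^^ a) ((dunklb m l \<kappa> ^^ b) q)))"

text \<open>
  The value at \<open>z = 0\<close> of an element of the space is a linear form \<open>c1 t + c2 t'\<close>, represented by
  \<open>(c1, c2)\<close>; \<open>tform\<close> is the given Hermitian form on these, with Gram matrix \<open>diag(2, 2)\<close>.
\<close>

definition at_zero :: "pspace \<Rightarrow> complex \<times> complex" where
  "at_zero f = (coeff (coeff (fst f) 0) 0, coeff (coeff (snd f) 0) 0)"

definition tform :: "complex \<times> complex \<Rightarrow> complex \<times> complex \<Rightarrow> complex" where
  "tform u v = 2 * (cnj (fst u) * fst v + cnj (snd u) * snd v)"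

definition form :: "nat \<Rightarrow> nat \<Rightarrow> real \<Rightarrow> pspace \<Rightarrow> pspace \<Rightarrow> complex" where
  "form m l \<kappa> p q = tform (1, 0) (at_zero (star_op m l \<kappa> (fst p) q))
                  + tform (0, 1) (at_zero (star_op m l \<kappa> (snd p) q))"

text \<open>
  The polynomials \<open>p_n^(1)\<close> and \<open>p_n^(2)\<close> are only meaningful for \<open>n \<ge> 1\<close>; the value at \<open>0\<close> is a dummy.
\<close>

primrec pol1 :: "nat \<Rightarrow> nat \<Rightarrow> real \<Rightarrow> nat \<Rightarrow> pspace" where
  "pol1 m l \<kappa> 0 = 0"
| "pol1 m l \<kappa> (Suc n) =
     (if n = 0 then pmul zv tv
      else if [int n + int l = 0] (mod int m)
      then pmul zv (pol1 m l \<kappa> n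
             + pscale (of_real (real m * \<kappa> / real n)) (sigma0 (pol1 m l \<kappa> n)))
      else pmul zv (pol1 m l \<kappa> n))"

primrec pol2 :: "nat \<Rightarrow> nat \<Rightarrow> real \<Rightarrow> nat \<Rightarrow> pspace" where
  "pol2 m l \<kappa> 0 = 0"
| "pol2 m l \<kappa> (Suc n) =
     (if n = 0 then pmul zv tbv
      else if [int n - int l = 0] (mod int m)
      then pmul zv (pol2 m l \<kappa> n
             + pscale (of_real (real m * \<kappa> / real n)) (sigma0 (pol2 m l \<kappa> n)))
      else pmul zv (pol2 m l \<kappa> n))"

subsection \<open>Exactness of the division\<close>

lemma bsubst_0 [simp]: "bsubst 0 x y = 0"
  by (simp add: bsubst_def)

lemma dvd_poly_diff: "(x - x') dvd (poly P x - poly P x')" for P :: "'a::comm_ring_1 poly"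
proof (induction P)
  case (pCons a P)
  have "poly (pCons a P) x - poly (pCons a P) x'
      = (x - x') * poly P x + x' * (poly P x - poly P x')"
    by (simp add: algebra_simps)
  then show ?case using pCons by (metis dvd_add dvd_mult dvd_triv_left)
qed simp

lemma bsubst_pCons: "bsubst (pCons q p) x y = poly (map_poly const q) y + x * bsubst p x y"
  by (cases "p = 0"; cases "q = 0") (simp_all add: bsubst_def map_poly_pCons)

lemma dvd_bsubst_diff:
  assumes "d dvd x - x'" "d dvd y - y'"
  shows "d dvd bsubst p x y - bsubst p x' y'"
proof (induction p)
  case (pCons q p)
  have "bsubst (pCons q p) x y - bsubst (pCons q p) x' y'
      = (poly (map_poly const q) y - poly (map_poly const q) y')
        + ((x - x') * bsubst p x y + x' * (bsubst p x y - bsubst p x' y'))"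
    by (simp add: bsubst_pCons algebra_simps)
  moreover have "d dvd poly (map_poly const q) y - poly (map_poly const q) y'"
    using assms(2) dvd_poly_diff dvd_trans by blast
  ultimately show ?case using pCons assms(1) by simp
qed simp

lemma denom_dvd_numer:
  "denom m j dvd fst (numer m l j f)" "denom m j dvd snd (numer m l j f)"
proof -
  define w where "w = omega m ^ j"
  have w: "w \<noteq> 0" by (simp add: w_def omega_def)
  have 1: "denom m j dvd zv - const (omega m powi int j) * zbv"
    by (simp add: denom_def)
  have i: "const (inverse w) * const w = 1"
    using w by (simp flip: const_simps)
  have "const (- inverse w) = - const (inverse w)"
    by (simp add: const_def)
  then have "const (- inverse w) * denom m j
      = (const (inverse w) * const w) * zbv - const (inverse w) * zv"
    by (simp add: denom_def algebra_simps flip: w_def del: const_simps)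
  then have "zbv - const (omega m powi (- int j)) * zv = const (- inverse w) * denom m j"
    by (simp add: i[unfolded w_def] w_def power_int_minus)
  then have 2: "denom m j dvd zbv - const (omega m powi (- int j)) * zv"
    by simp
  note d = dvd_bsubst_diff[OF 1 2]
  show "denom m j dvd fst (numer m l j f)" "denom m j dvd snd (numer m l j f)"
    using d[of "fst f"] d[of "snd f"]
    by (simp_all add: numer_def Let_def psubst_def pmul_def pscale_def tv_def tbv_def
        flip: left_diff_distrib)
qed

end

theory Submission
  imports Defs
begin

text \<open>
  Everything follows from product rules: with \<open>S\<^sub>k = \<Sum>\<^sub>j \<omega>^(jk) \<sigma>\<^sub>j\<close>, where \<open>\<sigma>\<^sub>j\<close> are the reflections,
  \<open>D(z f) = f + z D f + \<kappa> S\<^sub>0 f\<close> and \<open>D'(z f) = z D' f - \<kappa> S\<^sub>1 f\<close>, and symmetrically for \<open>z'\<close>.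
  On an element of weight \<open>w\<close> under the rotations, \<open>S\<^sub>k\<close> is \<open>m \<sigma>\<^sub>0\<close> if \<open>m\<close> divides \<open>w + k\<close> and \<open>0\<close>
  otherwise. Writing \<open>p\<^sub>n = z q\<^sub>n\<close>, induction gives \<open>D p\<^sub>n = n q\<^sub>n\<close>, \<open>D' q\<^sub>n = 0\<close> and
  \<open>D' p\<^sub>n = - \<kappa> S\<^sub>1 q\<^sub>n\<close>, hence harmonicity; since \<open>\<langle>z f, g\<rangle> = 2 \<langle>f, D g\<rangle>\<close>, it also gives all scalar
  products, with \<open>\<langle>q\<^sub>n\<^sub>+\<^sub>1, q\<^sub>n\<^sub>+\<^sub>1\<rangle> = 2 n \<langle>q\<^sub>n, q\<^sub>n\<rangle>\<close> up to a factor \<open>1 - (m \<kappa> / n)^2\<close> at the twisted steps.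

  That there are no further harmonic polynomials, for any real \<open>\<kappa>\<close>, rests on \<open>\<Sum>\<^sub>j \<omega>^(lj) = 0\<close>: it makes
  the Euler identity read \<open>z D g + z' D' g + \<kappa> S\<^sub>0 g = (deg g) g\<close>, so that
  \<open>D D' ((z z')^s g) = s (s + deg g) (z z')^(s-1) g + (z z')^s D D' g\<close> with a coefficient that does not
  involve \<open>\<kappa>\<close>. Hence no nonzero multiple of \<open>z z'\<close> is harmonic.
\<close>

section \<open>Substitution\<close>

lemma const_eq_0_iff [simp]: "const c = 0 \<longleftrightarrow> c = 0"
  by (simp add: const_def)

lemma const_minus: "const (- c) = - const c"
  by (simp add: const_def)

lemma const_sum: "const (sum f A) = (\<Sum>x\<in>A. const (f x))"
  by (induction A rule: infinite_finite_induct) auto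

lemma map_poly_const_add: "map_poly const (p + q) = map_poly const p + map_poly const q"
  by (intro poly_eqI) (simp add: coeff_map_poly)

lemma map_poly_const_mult: "map_poly const (p * q) = map_poly const p * map_poly const q"
  by (intro poly_eqI) (simp add: coeff_map_poly coeff_mult const_sum)

lemma bsubst_add: "bsubst (p + q) x y = bsubst p x y + bsubst q x y"
proof (induction p arbitrary: q)
  case (pCons a p)
  then show ?case
    by (cases q) (simp add: bsubst_pCons map_poly_const_add algebra_simps)
qed simp

lemma bsubst_smult: "bsubst (smult c p) x y = poly (map_poly const c) y * bsubst p x y"
  by (induction p) (simp_all add: bsubst_pCons map_poly_const_mult algebra_simps)

lemma bsubst_mult: "bsubst (p * q) x y = bsubst p x y * bsubst q x y"
  by (induction p) (simp_all add: bsubst_add bsubst_smult bsubst_pCons algebra_simps)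

lemma bsubst_const [simp]: "bsubst (const c) x y = const c"
  by (cases "c = 0") (simp_all add: const_def bsubst_pCons map_poly_pCons)

lemma bsubst_1 [simp]: "bsubst 1 x y = 1"
  using bsubst_const[of 1] by simp

lemma bsubst_zv [simp]: "bsubst zv x y = x"
  by (simp add: zv_def bsubst_pCons map_poly_pCons)

lemma bsubst_zbv [simp]: "bsubst zbv x y = y"
  by (simp add: zbv_def bsubst_pCons map_poly_pCons)

text \<open>The monomial case is restricted to monomials that occur in \<open>p\<close>, so that
  homogeneity of \<open>p\<close> can be used there.\<close>

lemma bpoly_induct [case_names zero add monom]:
  assumes "P 0"
    and "\<And>p q. P p \<Longrightarrow> P q \<Longrightarrow> P (p + q)"
    and "\<And>a b. coeff (coeff p a) b \<noteq> 0 \<Longrightarrow> P (const (coeff (coeff p a) b) * (zv ^ a * zbv ^ b))"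
  shows "P p"
proof -
  have sumP: "P (sum f A)" if "\<And>x. x \<in> A \<Longrightarrow> P (f x)" for f and A :: "nat set"
    using that by (induction A rule: infinite_finite_induct) (auto intro: assms)
  have zv: "zv ^ a = monom 1 a" for a
    by (simp add: zv_def monom_altdef)
  have zbv: "zbv ^ b = [:monom 1 b:]" for b
    by (induction b) (simp_all add: zbv_def monom_0 monom_Suc one_pCons)
  have mon: "const c * (zv ^ a * zbv ^ b) = monom (monom c b) a" for a b c
    by (simp add: zv zbv const_def smult_monom monom_altdef)
  have "p = (\<Sum>a\<le>degree p. monom (coeff p a) a)"
    by (simp add: poly_as_sum_of_monoms)
  also have "\<dots> = (\<Sum>a\<le>degree p. \<Sum>b\<le>degree (coeff p a). monom (monom (coeff (coeff p a) b) b) a)"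
  proof (intro sum.cong refl)
    fix a
    have "monom (coeff p a) a = monom (\<Sum>b\<le>degree (coeff p a). monom (coeff (coeff p a) b) b) a"
      by (simp add: poly_as_sum_of_monoms)
    then show "monom (coeff p a) a
        = (\<Sum>b\<le>degree (coeff p a). monom (monom (coeff (coeff p a) b) b) a)"
      by (simp add: monom_sum)
  qed
  finally have eq: "p = \<dots>" .
  have "P (monom (monom (coeff (coeff p a) b) b) a)" for a b
    using assms(1) assms(3)[of a b] by (cases "coeff (coeff p a) b = 0") (simp_all add: mon)
  then have "P (\<Sum>a\<le>degree p. \<Sum>b\<le>degree (coeff p a). monom (monom (coeff (coeff p a) b) b) a)"
    by (intro sumP)
  then show ?thesis
    by (rule subst[where P = P, OF eq[symmetric]])
qed

section \<open>Polynomials with values in the linear forms\<close>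

lemma fst_pmul [simp]: "fst (pmul g f) = g * fst f"
  and snd_pmul [simp]: "snd (pmul g f) = g * snd f"
  by (simp_all add: pmul_def)

lemma fst_pscale [simp]: "fst (pscale c f) = const c * fst f"
  and snd_pscale [simp]: "snd (pscale c f) = const c * snd f"
  by (simp_all add: pscale_def)

lemma pmul_add: "pmul g (x + y) = pmul g x + pmul g y"
  and pmul_pscale: "pmul g (pscale c x) = pscale c (pmul g x)"
  by (simp_all add: prod_eq_iff algebra_simps)

text \<open>\<open>W\<close> is carried along monomials only and need not survive sums. Having a
  pure weight is such a property, and it can support the proof of a linear statement
  \<open>P\<close>.\<close>

lemma pspace_induct_strong:
  assumes add: "\<And>x y. P x \<Longrightarrow> P y \<Longrightarrow> P (x + y)"
    and scale: "\<And>c x. P x \<Longrightarrow> P (pscale c x)"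
    and tv: "W tv" "P tv" and tbv: "W tbv" "P tbv"
    and zv: "\<And>x. W x \<Longrightarrow> P x \<Longrightarrow> W (pmul zv x) \<and> P (pmul zv x)"
    and zbv: "\<And>x. W x \<Longrightarrow> P x \<Longrightarrow> W (pmul zbv x) \<and> P (pmul zbv x)"
  shows "P f"
proof -
  have mon: "P (pmul (zv ^ a * zbv ^ b) e)" if e: "W e" "P e" for a b e
  proof -
    have "W (pmul (zbv ^ b) e) \<and> P (pmul (zbv ^ b) e)"
    proof (induction b)
      case (Suc b)
      then show ?case using zbv[of "pmul (zbv ^ b) e"] by (simp add: pmul_def mult.assoc)
    qed (use e in \<open>simp add: pmul_def\<close>)
    then have "W (pmul (zv ^ a * zbv ^ b) e) \<and> P (pmul (zv ^ a * zbv ^ b) e)"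
    proof (induction a)
      case (Suc a)
      then show ?case using zv[of "pmul (zv ^ a * zbv ^ b) e"] by (simp add: pmul_def mult.assoc)
    qed simp
    then show ?thesis ..
  qed
  have *: "P (pmul p e)" if e: "W e" "P e" for p e
  proof (induction p rule: bpoly_induct)
    case zero
    then show ?case using scale[OF e(2), of 0] by (simp add: pmul_def pscale_def)
  next
    case (add p q)
    then show ?case using assms(1)[OF add] by (simp add: pmul_def algebra_simps)
  next
    case (monom a b)
    then show ?case using scale[OF mon[OF e, of a b], of "coeff (coeff p a) b"]
      by (simp add: pscale_def pmul_def mult.assoc)
  qed
  have "f = pmul (fst f) tv + pmul (snd f) tbv"
    by (simp add: prod_eq_iff tv_def tbv_def)
  then show ?thesis
    using add[OF *[OF tv] *[OF tbv]] by metis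
qed

lemmas pspace_induct [case_names add scale tv tbv zv zbv] =
  pspace_induct_strong[where W = "\<lambda>_. True", simplified]

lemma sigma0_eq: "sigma0 f = (bsubst (snd f) zbv zv, bsubst (fst f) zbv zv)"
  by (simp add: sigma0_def psubst_def pmul_def tv_def tbv_def)

lemma sigma0_add: "sigma0 (x + y) = sigma0 x + sigma0 y"
  and sigma0_pscale: "sigma0 (pscale c x) = pscale c (sigma0 x)"
  and sigma0_zv: "sigma0 (pmul zv x) = pmul zbv (sigma0 x)"
  and sigma0_zbv: "sigma0 (pmul zbv x) = pmul zv (sigma0 x)"
  and sigma0_tv: "sigma0 tv = tbv"
  and sigma0_tbv: "sigma0 tbv = tv"
  by (simp_all add: prod_eq_iff sigma0_eq bsubst_add bsubst_mult tv_def tbv_def)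

lemmas sigma0_simps = sigma0_add sigma0_pscale sigma0_zv sigma0_zbv sigma0_tv sigma0_tbv

lemma sigma0_0 [simp]: "sigma0 0 = 0"
  by (simp add: sigma0_eq prod_eq_iff)

lemma sigma0_sigma0 [simp]: "sigma0 (sigma0 f) = f"
  by (induction f rule: pspace_induct) (simp_all add: sigma0_simps)

text \<open>\<open>sigma m l j\<close> is the action of the reflection \<open>z \<mapsto> z' \<omega>^j\<close> on both groups of variables.\<close>

definition sigma :: "nat \<Rightarrow> nat \<Rightarrow> nat \<Rightarrow> pspace \<Rightarrow> pspace" where
  "sigma m l j f = psubst f (const (omega m powi int j) * zbv) (const (omega m powi (- int j)) * zv)
     (pscale (omega m powi (int l * int j)) tbv) (pscale (omega m powi (- (int l * int j))) tv)"

text \<open>The reflection applied to \<open>t\<close> and \<open>t'\<close> alone, which is the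
  minuend of the numerator; it is linear over the polynomials in \<open>z\<close> and
  \<open>z'\<close>.\<close>

definition tflip :: "nat \<Rightarrow> nat \<Rightarrow> nat \<Rightarrow> pspace \<Rightarrow> pspace" where
  "tflip m l j f = (const (omega m powi (- (int l * int j))) * snd f, const (omega m powi (int l * int j)) * fst f)"

lemma bsubst_power: "bsubst (p ^ n) x y = bsubst p x y ^ n"
  by (induction n) (simp_all add: bsubst_mult)

lemma bsubst_id: "bsubst p zv zbv = p"
  by (induction p rule: bpoly_induct) (simp_all add: bsubst_add bsubst_mult bsubst_power)

lemma numer_eq: "numer m l j f = tflip m l j f - sigma m l j f"
  by (simp add: numer_def tflip_def sigma_def Let_def psubst_def bsubst_id prod_eq_iff tv_def tbv_def)

lemma omega_nz [simp]: "omega m \<noteq> 0"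
  by (simp add: omega_def)

lemma sigma_add: "sigma m l j (x + y) = sigma m l j x + sigma m l j y"
  and sigma_pscale: "sigma m l j (pscale c x) = pscale c (sigma m l j x)"
  and sigma_zv: "sigma m l j (pmul zv x) = pscale (omega m powi int j) (pmul zbv (sigma m l j x))"
  and sigma_zbv: "sigma m l j (pmul zbv x) = pscale (omega m powi (- int j)) (pmul zv (sigma m l j x))"
  and sigma_tv: "sigma m l j tv = pscale (omega m powi (int l * int j)) tbv"
  and sigma_tbv: "sigma m l j tbv = pscale (omega m powi (- (int l * int j))) tv"
  by (simp_all add: prod_eq_iff sigma_def psubst_def bsubst_add bsubst_mult tv_def tbv_def algebra_simps)

lemmas sigma_simps = sigma_add sigma_pscale sigma_zv sigma_zbv sigma_tv sigma_tbv

section \<open>Divided differences along the reflections\<close>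

text \<open>\<open>denom m j\<close> is nonzero in an integral domain, so an exact quotient is
  identified by multiplying out. The rules for \<open>dquot\<close> below are verified this
  way.\<close>

lemma dquot_eqI:
  assumes "pmul (denom m j) g = tflip m l j f - sigma m l j f"
  shows "dquot m l j f = g"
proof -
  have "denom m j \<noteq> 0"
    by (auto simp: denom_def zv_def zbv_def const_def)
  then show ?thesis
    using assms unfolding dquot_def numer_eq[symmetric]
    by (metis fst_pmul snd_pmul nonzero_mult_div_cancel_left prod.collapse)
qed

lemma dquot: "pmul (denom m j) (dquot m l j f) = tflip m l j f - sigma m l j f"
  unfolding numer_eq[symmetric] dquot_def using denom_dvd_numer by (simp add: prod_eq_iff)

lemma dquot_add: "dquot m l j (x + y) = dquot m l j x + dquot m l j y"
  by (rule dquot_eqI) (simp add: pmul_add dquot sigma_add, simp add: tflip_def prod_eq_iff algebra_simps)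

lemma dquot_pscale: "dquot m l j (pscale c x) = pscale c (dquot m l j x)"
  by (rule dquot_eqI) (simp add: pmul_pscale dquot sigma_pscale, simp add: tflip_def prod_eq_iff algebra_simps)

lemma dquot_tv: "dquot m l j tv = 0"
  by (rule dquot_eqI) (simp add: sigma_tv, simp add: tflip_def prod_eq_iff tv_def tbv_def)

lemma dquot_tbv: "dquot m l j tbv = 0"
  by (rule dquot_eqI) (simp add: sigma_tbv, simp add: tflip_def prod_eq_iff tv_def tbv_def)

lemma pmul_denom: "pmul (denom m j) x = pmul zv x - pscale (omega m ^ j) (pmul zbv x)"
  by (simp add: denom_def prod_eq_iff algebra_simps)

lemma tflip_pmul: "tflip m l j (pmul g x) = pmul g (tflip m l j x)"
  by (simp add: tflip_def prod_eq_iff algebra_simps)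

text \<open>Twisted Leibniz rule: with \<tau> for \<open>tflip\<close> and \<sigma> for
  \<open>sigma\<close>, \<open>z \<tau> x - \<omega>^j z' \<sigma> x = z (\<tau> x - \<sigma> x) +
  (z - \<omega>^j z') \<sigma> x\<close>.\<close>

lemma dquot_zv: "dquot m l j (pmul zv x) = pmul zv (dquot m l j x) + sigma m l j x"
proof (rule dquot_eqI)
  have "pmul (denom m j) (pmul zv (dquot m l j x) + sigma m l j x)
     = pmul zv (pmul (denom m j) (dquot m l j x)) + pmul (denom m j) (sigma m l j x)"
    by (simp add: prod_eq_iff algebra_simps)
  also have "\<dots> = tflip m l j (pmul zv x) - sigma m l j (pmul zv x)"
    unfolding dquot pmul_denom[of _ _ "sigma m l j x"] sigma_zv tflip_pmul
    by (simp add: prod_eq_iff algebra_simps)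
  finally show "pmul (denom m j) (pmul zv (dquot m l j x) + sigma m l j x) = \<dots>" .
qed

lemma const_power: "const (c ^ n) = const c ^ n"
  by (induction n) simp_all

text \<open>Similarly, \<open>z' \<tau> x - \<omega>^(-j) z \<sigma> x = z' (\<tau> x - \<sigma> x)
  - \<omega>^(-j) (z - \<omega>^j z') \<sigma> x\<close>.\<close>

lemma dquot_zbv:
  "dquot m l j (pmul zbv x) = pmul zbv (dquot m l j x) - pscale (omega m powi (- int j)) (sigma m l j x)"
proof (rule dquot_eqI)
  have c: "const (omega m powi (- int j)) * const (omega m) ^ j = 1"
    by (simp add: power_int_minus flip: const_simps const_power)
  have "pmul (denom m j) (pmul zbv (dquot m l j x) - pscale (omega m powi (- int j)) (sigma m l j x))
     = pmul zbv (pmul (denom m j) (dquot m l j x))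
       - pscale (omega m powi (- int j)) (pmul (denom m j) (sigma m l j x))"
    by (simp add: prod_eq_iff algebra_simps)
  also have "\<dots> = pmul zbv (tflip m l j x - sigma m l j x)
      - (pscale (omega m powi (- int j)) (pmul zv (sigma m l j x))
         - pmul (const (omega m powi (- int j)) * const (omega m) ^ j) (pmul zbv (sigma m l j x)))"
    unfolding dquot pmul_denom[of _ _ "sigma m l j x"]
    by (simp add: prod_eq_iff algebra_simps const_power)
  also have "\<dots> = tflip m l j (pmul zbv x) - sigma m l j (pmul zbv x)"
    unfolding c sigma_zbv tflip_pmul by (simp add: prod_eq_iff algebra_simps)
  finally show "pmul (denom m j) (pmul zbv (dquot m l j x)
      - pscale (omega m powi (- int j)) (sigma m l j x)) = \<dots>" .
qed

section \<open>Product rules for the Dunkl operators\<close>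

lemma zv_mult: "zv * p = pCons 0 p"
  by (simp add: zv_def)

lemma zbv_mult: "zbv * p = smult [:0, 1:] p"
  by (simp add: zbv_def)

lemma const_mult: "const c * p = smult [:c:] p"
  by (simp add: const_def)

lemma map_pderiv_add: "map_poly pderiv (p + q) = map_poly pderiv p + map_poly pderiv q"
  by (intro poly_eqI) (simp add: coeff_map_poly pderiv_add)

lemma map_pderiv_smult:
  "map_poly pderiv (smult a p) = smult a (map_poly pderiv p) + smult (pderiv a) p"
  by (rule poly_eqI) (simp add: coeff_map_poly pderiv_mult algebra_simps)

lemma dz_add: "dz (x + y) = dz x + dz y"
  and dz_pscale: "dz (pscale c x) = pscale c (dz x)"
  and dz_zv: "dz (pmul zv x) = x + pmul zv (dz x)"
  and dz_zbv: "dz (pmul zbv x) = pmul zbv (dz x)"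
  by (simp_all add: dz_def prod_eq_iff pderiv_add zv_mult zbv_mult const_mult pderiv_pCons pderiv_smult)

lemma dzb_add: "dzb (x + y) = dzb x + dzb y"
  and dzb_pscale: "dzb (pscale c x) = pscale c (dzb x)"
  and dzb_zv: "dzb (pmul zv x) = pmul zv (dzb x)"
  and dzb_zbv: "dzb (pmul zbv x) = x + pmul zbv (dzb x)"
  by (simp_all add: dzb_def prod_eq_iff map_pderiv_add zv_mult zbv_mult const_mult map_poly_pCons
      map_pderiv_smult pderiv_pCons one_pCons[symmetric])

lemma dz_tv: "dz tv = 0" "dz tbv = 0" "dzb tv = 0" "dzb tbv = 0"
  by (simp_all add: dz_def dzb_def tv_def tbv_def prod_eq_iff map_poly_pCons one_pCons pderiv_pCons)

definition sigsum :: "nat \<Rightarrow> nat \<Rightarrow> int \<Rightarrow> pspace \<Rightarrow> pspace" where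
  "sigsum m l k f = (\<Sum>j<m. pscale (omega m powi (int j * k)) (sigma m l j f))"

text \<open>The difference parts of \<open>D\<close> and \<open>D'\<close> are the cases
  \<open>k = 0\<close> and \<open>k = 1\<close>, with factors \<kappa> and -\<kappa>.\<close>

definition dquotsum :: "nat \<Rightarrow> nat \<Rightarrow> int \<Rightarrow> pspace \<Rightarrow> pspace" where
  "dquotsum m l k f = (\<Sum>j<m. pscale (omega m powi (int j * k)) (dquot m l j f))"

lemma pmul_sum: "pmul g (\<Sum>x\<in>A. h x) = (\<Sum>x\<in>A. pmul g (h x))"
  by (simp add: prod_eq_iff fst_sum snd_sum sum_distrib_left)

lemma pscale_sum: "pscale c (\<Sum>x\<in>A. h x) = (\<Sum>x\<in>A. pscale c (h x))"
  by (simp add: pscale_def pmul_sum)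

lemma pscale_add: "pscale c (x + y) = pscale c x + pscale c y"
  and pscale_diff: "pscale c (x - y) = pscale c x - pscale c y"
  and pscale_pscale: "pscale a (pscale b x) = pscale (a * b) x"
  and pscale_0: "pscale 0 x = 0" and pscale_1: "pscale 1 x = x" and pscale_zero: "pscale c 0 = 0"
  by (simp_all add: prod_eq_iff algebra_simps)

lemma sigsum_add: "sigsum m l k (x + y) = sigsum m l k x + sigsum m l k y"
  and sigsum_pscale: "sigsum m l k (pscale c x) = pscale c (sigsum m l k x)"
  by (simp_all add: sigsum_def sigma_simps pscale_add sum.distrib pscale_sum pscale_pscale mult.commute)

lemma powi_shift:
  "omega m powi (int j * k) * omega m powi int j = omega m powi (int j * (k + 1))"
  "omega m powi (int j * k) * omega m powi (- int j) = omega m powi (int j * (k - 1))"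
  by (subst power_int_add[symmetric]; simp add: algebra_simps)+

text \<open>The factor \<open>\<omega>^j\<close> that \<open>z\<close> picks up under the
  \<open>j\<close>-th reflection raises the frequency \<open>k\<close> by one; \<open>z'\<close>
  lowers it.\<close>

lemma sigsum_zv: "sigsum m l k (pmul zv x) = pmul zbv (sigsum m l (k + 1) x)"
  and sigsum_zbv: "sigsum m l k (pmul zbv x) = pmul zv (sigsum m l (k - 1) x)"
  unfolding sigsum_def sigma_simps pmul_sum pscale_pscale pmul_pscale powi_shift by (rule refl)+

lemma dquotsum_add: "dquotsum m l k (x + y) = dquotsum m l k x + dquotsum m l k y"
  and dquotsum_pscale: "dquotsum m l k (pscale c x) = pscale c (dquotsum m l k x)"
  and dquotsum_zv: "dquotsum m l k (pmul zv x) = pmul zv (dquotsum m l k x) + sigsum m l k x"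
  and dquotsum_tv: "dquotsum m l k tv = 0" "dquotsum m l k tbv = 0"
  by (simp_all add: dquotsum_def sigsum_def dquot_add dquot_pscale dquot_zv dquot_tv dquot_tbv pscale_add
      sum.distrib pscale_sum pscale_pscale pscale_zero mult.commute pmul_sum pmul_pscale)

lemma dquotsum_zbv:
  "dquotsum m l k (pmul zbv x) = pmul zbv (dquotsum m l k x) - sigsum m l (k - 1) x"
  unfolding dquotsum_def sigsum_def dquot_zbv pscale_diff sum_subtractf pscale_pscale powi_shift
    pmul_sum pmul_pscale by (rule refl)

lemma dunkl_alt: "dunkl m l \<kappa> f = dz f + pscale (of_real \<kappa>) (dquotsum m l 0 f)"
  by (simp add: dunkl_def dquotsum_def pscale_1)

lemma dunklb_alt: "dunklb m l \<kappa> f = dzb f - pscale (of_real \<kappa>) (dquotsum m l 1 f)"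
  by (simp add: dunklb_def dquotsum_def)

lemma dunkl_add: "dunkl m l \<kappa> (x + y) = dunkl m l \<kappa> x + dunkl m l \<kappa> y"
  and dunkl_pscale: "dunkl m l \<kappa> (pscale c x) = pscale c (dunkl m l \<kappa> x)"
  and dunkl_zv: "dunkl m l \<kappa> (pmul zv x)
     = x + pmul zv (dunkl m l \<kappa> x) + pscale (of_real \<kappa>) (sigsum m l 0 x)"
  and dunkl_zbv: "dunkl m l \<kappa> (pmul zbv x)
     = pmul zbv (dunkl m l \<kappa> x) - pscale (of_real \<kappa>) (sigsum m l (- 1) x)"
  and dunkl_tv: "dunkl m l \<kappa> tv = 0" "dunkl m l \<kappa> tbv = 0"
  by (simp_all add: dunkl_alt dz_add dz_pscale dz_zv dz_zbv dz_tv dquotsum_add dquotsum_pscale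
      dquotsum_zv dquotsum_zbv dquotsum_tv pscale_zero)
     (simp_all add: prod_eq_iff algebra_simps)

lemma dunklb_add: "dunklb m l \<kappa> (x + y) = dunklb m l \<kappa> x + dunklb m l \<kappa> y"
  and dunklb_pscale: "dunklb m l \<kappa> (pscale c x) = pscale c (dunklb m l \<kappa> x)"
  and dunklb_zv: "dunklb m l \<kappa> (pmul zv x)
     = pmul zv (dunklb m l \<kappa> x) - pscale (of_real \<kappa>) (sigsum m l 1 x)"
  and dunklb_zbv: "dunklb m l \<kappa> (pmul zbv x)
     = x + pmul zbv (dunklb m l \<kappa> x) + pscale (of_real \<kappa>) (sigsum m l 0 x)"
  and dunklb_tv: "dunklb m l \<kappa> tv = 0" "dunklb m l \<kappa> tbv = 0"
  by (simp_all add: dunklb_alt dzb_add dzb_pscale dzb_zv dzb_zbv dz_tv dquotsum_add dquotsum_pscale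
      dquotsum_zv dquotsum_zbv dquotsum_tv pscale_zero)
     (simp_all add: prod_eq_iff algebra_simps)

lemmas dunkl_simps = dunkl_add dunkl_pscale dunkl_zv dunkl_zbv dunkl_tv
lemmas dunklb_simps = dunklb_add dunklb_pscale dunklb_zv dunklb_zbv dunklb_tv

section \<open>Weights\<close>

text \<open>Eigenvectors of the rotations: \<open>sigma0\<close> after \<open>sigma m l j\<close> is
  the rotation multiplying \<open>z\<close> by \<open>\<omega>^j\<close>, and it has to act by
  \<open>\<omega>^(j w)\<close>. Only \<open>w\<close> modulo \<open>m\<close> matters.\<close>

definition wt :: "nat \<Rightarrow> nat \<Rightarrow> int \<Rightarrow> pspace \<Rightarrow> bool" where
  "wt m l w f \<longleftrightarrow> (\<forall>j. sigma m l j f = pscale (omega m powi (int j * w)) (sigma0 f))"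

lemma omega_powi_eq_1_iff:
  assumes "m > 0"
  shows "omega m powi k = 1 \<longleftrightarrow> int m dvd k"
proof -
  have "omega m powi k = exp (of_int k * (2 * of_real pi * \<i> / of_nat m))"
    by (simp add: omega_def exp_power_int)
  also have "\<dots> = 1 \<longleftrightarrow> (\<exists>n::int. of_int k * (2 * pi) / of_nat m = of_int (2 * n) * pi)"
    by (simp add: exp_eq_1)
  also have "\<dots> \<longleftrightarrow> (\<exists>n::int. k = int m * n)"
  proof -
    have "of_int k * (2 * pi) / of_nat m = of_int (2 * n) * pi \<longleftrightarrow> k = int m * n" for n :: int
    proof -
      have "of_int k * (2 * pi) / of_nat m = of_int (2 * n) * pi
          \<longleftrightarrow> (of_int k :: real) = of_nat m * of_int n"
        using assms by (simp add: field_simps)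
      also have "\<dots> \<longleftrightarrow> k = int m * n"
        by (metis of_int_eq_iff of_int_mult of_int_of_nat_eq)
      finally show ?thesis .
    qed
    then show ?thesis by simp
  qed
  finally show ?thesis by (auto simp: dvd_def)
qed

lemma sum_omega_powi:
  assumes "m > 0"
  shows "(\<Sum>j<m. omega m powi (int j * k)) = (if int m dvd k then of_nat m else 0)"
proof -
  define c where "c = omega m powi k"
  have pow: "omega m powi (int j * k) = c ^ j" for j
    unfolding c_def by (metis mult.commute power_int_mult power_int_of_nat)
  have "c ^ m = 1"
    using assms by (simp add: omega_powi_eq_1_iff flip: pow)
  then show ?thesis
    using assms by (auto simp: pow sum_gp_strict c_def omega_powi_eq_1_iff)
qed

text \<open>The geometric sum of the \<open>\<omega>^(j (w + k))\<close> vanishes unless all its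
  terms are \<open>1\<close>.\<close>

lemma sigsum_wt:
  assumes "m > 0" "wt m l w f"
  shows "sigsum m l k f = pscale (if int m dvd w + k then of_nat m else 0) (sigma0 f)"
proof -
  have "sigsum m l k f = (\<Sum>j<m. pscale (omega m powi (int j * (w + k))) (sigma0 f))"
    using assms(2) unfolding sigsum_def wt_def
    by (simp add: pscale_pscale algebra_simps flip: power_int_add)
  also have "\<dots> = pscale (\<Sum>j<m. omega m powi (int j * (w + k))) (sigma0 f)"
    by (simp add: pspace.scale_sum_left)
  finally show ?thesis
    using assms(1) by (simp add: sum_omega_powi)
qed

lemma sigma_sigma: "sigma m l j (sigma m l j f) = f"
  by (induction f rule: pspace_induct)
     (simp_all add: sigma_simps pscale_pscale power_int_minus pmul_pscale pscale_1)

lemma wt_add: "wt m l w x \<Longrightarrow> wt m l w y \<Longrightarrow> wt m l w (x + y)"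
  and wt_pscale: "wt m l w x \<Longrightarrow> wt m l w (pscale c x)"
  and wt_0: "wt m l w 0"
  and wt_tv: "wt m l (int l) tv" and wt_tbv: "wt m l (- int l) tbv"
  using sigma_pscale[of m l _ 0 0]
  by (simp_all add: wt_def sigma_simps sigma0_simps pscale_pscale pscale_add pscale_zero mult.commute)

lemma wt_zv: "wt m l w x \<Longrightarrow> wt m l (w + 1) (pmul zv x)"
  and wt_zbv: "wt m l w x \<Longrightarrow> wt m l (w - 1) (pmul zbv x)"
  by (simp_all add: wt_def sigma_simps sigma0_simps pmul_pscale pscale_pscale mult.commute
      flip: powi_shift)

text \<open>Each \<open>sigma m l j\<close> is an involution, so applying it to the weight condition
  for \<open>f\<close> inverts the scalar.\<close>

lemma wt_sigma0:
  assumes "wt m l w f"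
  shows "wt m l (- w) (sigma0 f)"
  unfolding wt_def
proof
  fix j
  have "f = sigma m l j (sigma m l j f)"
    by (simp add: sigma_sigma)
  also have "\<dots> = pscale (omega m powi (int j * w)) (sigma m l j (sigma0 f))"
    using assms by (simp add: wt_def sigma_pscale)
  finally have "pscale (omega m powi (int j * - w)) f
      = pscale (omega m powi (int j * - w) * omega m powi (int j * w)) (sigma m l j (sigma0 f))"
    by (metis pscale_pscale)
  then show "sigma m l j (sigma0 f) = pscale (omega m powi (int j * - w)) (sigma0 (sigma0 f))"
    by (simp add: pscale_1 flip: power_int_add)
qed

lemma wt_cong:
  assumes "wt m l w f" "int m dvd w - w'"
  shows "wt m l w' f"
proof (cases "m = 0")
  case False
  have "omega m powi (int j * w) = omega m powi (int j * w')" for j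
  proof -
    have "omega m powi (int j * w) = omega m powi (int j * (w - w')) * omega m powi (int j * w')"
      by (simp add: algebra_simps flip: power_int_add)
    then show ?thesis
      using False assms(2) omega_powi_eq_1_iff[of m "int j * (w - w')"] by simp
  qed
  then show ?thesis
    using assms(1) by (simp add: wt_def)
qed (use assms in simp)

lemma wt_induct [case_names add scale tv tbv zv zbv]:
  assumes add: "\<And>x y. P x \<Longrightarrow> P y \<Longrightarrow> P (x + y)"
    and scale: "\<And>c x. P x \<Longrightarrow> P (pscale c x)"
    and tv: "P tv" and tbv: "P tbv"
    and zv: "\<And>w x. wt m l w x \<Longrightarrow> P x \<Longrightarrow> P (pmul zv x)"
    and zbv: "\<And>w x. wt m l w x \<Longrightarrow> P x \<Longrightarrow> P (pmul zbv x)"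
  shows "P f"
proof (rule pspace_induct_strong[where W = "\<lambda>x. \<exists>w. wt m l w x" and P = P])
  show "\<exists>w. wt m l w tv" "\<exists>w. wt m l w tbv"
    using wt_tv wt_tbv by blast+
  show "(\<exists>w. wt m l w (pmul zv x)) \<and> P (pmul zv x)" if "\<exists>w. wt m l w x" "P x" for x
    using that zv wt_zv by blast
  show "(\<exists>w. wt m l w (pmul zbv x)) \<and> P (pmul zbv x)" if "\<exists>w. wt m l w x" "P x" for x
    using that zbv wt_zbv by blast
qed (fact add scale tv tbv)+

lemmas pspace_lin = pmul_add pmul_pscale pscale_add pscale_diff pscale_pscale

section \<open>Commutation of the Dunkl operators with the flip and with each other\<close>

text \<open>By \<open>nd\<close> the weights \<open>l\<close> and \<open>-l\<close> of
  \<open>t\<close> and \<open>t'\<close> are nonzero modulo \<open>m\<close>, so that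
  \<open>S 0\<close> vanishes on both.\<close>

locale dihedral =
  fixes m l :: nat and \<kappa> :: real
  assumes m: "m > 0" and nd: "\<not> m dvd l"
begin

abbreviation D where "D \<equiv> dunkl m l \<kappa>"
abbreviation D' where "D' \<equiv> dunklb m l \<kappa>"
abbreviation S where "S \<equiv> sigsum m l"

lemma dunkl_0 [simp]: "D 0 = 0" "D' 0 = 0"
  using dunkl_pscale[of m l \<kappa> 0 0] dunklb_pscale[of m l \<kappa> 0 0] by (simp_all add: pscale_0)

lemma pmul_0 [simp]: "pmul g 0 = 0"
  by (simp add: prod_eq_iff)

lemma sigsum_0 [simp]: "S k 0 = 0"
  using sigsum_pscale[of m l k 0 0] by (simp add: pscale_0)

lemma pscale_uminus: "pscale (- c) x = - pscale c x"
  by (simp add: prod_eq_iff const_minus)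

lemma operators_minus:
  "D (- x) = - D x" "D' (- x) = - D' x" "S k (- x) = - S k x" "sigma0 (- x) = - sigma0 x"
  "D (x - y) = D x - D y" "D' (x - y) = D' x - D' y"
  "S k (x - y) = S k x - S k y" "sigma0 (x - y) = sigma0 x - sigma0 y"
proof -
  have *: "- x = pscale (-1) x" for x
    by (simp add: prod_eq_iff const_minus)
  have u: "D (- x) = - D x" "D' (- x) = - D' x" "S k (- x) = - S k x" "sigma0 (- x) = - sigma0 x" for x
    unfolding * by (simp_all only: dunkl_pscale dunklb_pscale sigsum_pscale sigma0_pscale)
  show "D (- x) = - D x" "D' (- x) = - D' x" "S k (- x) = - S k x" "sigma0 (- x) = - sigma0 x"
    by (fact u)+
  show "D (x - y) = D x - D y" "D' (x - y) = D' x - D' y"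
    "S k (x - y) = S k x - S k y" "sigma0 (x - y) = sigma0 x - sigma0 y"
    using dunkl_add[of m l \<kappa> x "- y"] dunklb_add[of m l \<kappa> x "- y"] sigsum_add[of m l k x "- y"]
      sigma0_add[of x "- y"] by (simp_all add: u)
qed

lemmas S_wt = sigsum_wt[OF m]

lemma dvd_swap: "int m dvd - w + k \<longleftrightarrow> int m dvd w - k"
  using dvd_minus_iff[of "int m" "w - k"] by simp

text \<open>Conjugation by \<open>sigma0\<close> inverts the rotations. On pure weight
  \<open>w\<close> both sides are the same multiple of \<open>f\<close>, since
  \<open>sigma0 f\<close> has weight \<open>- w\<close>; the multiplication cases therefore use no
  induction hypothesis.\<close>

lemma S_sigma0: "S k (sigma0 f) = sigma0 (S (- k) f)"
proof (induction f rule: wt_induct[where m = m and l = l])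
  case (zv w x)
  note w = wt_zv[OF zv(1)]
  show ?case
    unfolding S_wt[OF w] S_wt[OF wt_sigma0[OF w]] dvd_swap by (simp add: sigma0_pscale)
next
  case (zbv w x)
  note w = wt_zbv[OF zbv(1)]
  show ?case
    unfolding S_wt[OF w] S_wt[OF wt_sigma0[OF w]] dvd_swap by (simp add: sigma0_pscale)
next
  case tv
  show ?case
    unfolding S_wt[OF wt_tv] S_wt[OF wt_sigma0[OF wt_tv]] dvd_swap by (simp add: sigma0_pscale)
next
  case tbv
  show ?case
    using dvd_minus_iff[of "int m" "int l + k"]
    unfolding S_wt[OF wt_tbv] S_wt[OF wt_sigma0[OF wt_tbv]] by (simp add: sigma0_pscale)
qed (simp_all add: sigma0_simps sigsum_add sigsum_pscale)

text \<open>The flip exchanges the product rules for \<open>z\<close> and \<open>z'\<close>, with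
  \<open>S 1\<close> and \<open>S (- 1)\<close> trading places.\<close>

lemma sigma0_D: "sigma0 (D f) = D' (sigma0 f)"
  by (induction f rule: pspace_induct)
     (simp_all add: dunkl_simps dunklb_simps sigma0_simps S_sigma0 operators_minus)

lemma sigma0_D': "sigma0 (D' f) = D (sigma0 f)"
  by (metis sigma0_D sigma0_sigma0)

lemma wt_uminus: "wt m l w x \<Longrightarrow> wt m l w (- x)"
  using wt_pscale[of m l w x "-1"] by (simp add: prod_eq_iff const_minus)

text \<open>\<open>S k f\<close> is either \<open>0\<close>, which has every weight, or a multiple
  of \<open>sigma0 f\<close>, of weight \<open>- w\<close>; the second assumption says that
  \<open>u\<close> and \<open>- w\<close> agree modulo \<open>m\<close> in that case.\<close>

lemma wt_S:
  assumes "wt m l w f" "int m dvd w + k \<Longrightarrow> int m dvd w + u"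
  shows "wt m l u (S k f)"
proof (cases "int m dvd w + k")
  case True
  then have "wt m l u (sigma0 f)"
    using wt_cong[OF wt_sigma0[OF assms(1)], of u] assms(2) dvd_minus_iff[of "int m" "w + u"] by simp
  then show ?thesis
    by (simp add: S_wt[OF assms(1)] wt_pscale)
qed (simp add: S_wt[OF assms(1)] pscale_0 wt_0)

lemma wt_diff: "wt m l w x \<Longrightarrow> wt m l w y \<Longrightarrow> wt m l w (x - y)"
  using wt_add[of m l w x "- y"] wt_uminus[of w y] by simp

text \<open>\<open>D\<close> lowers and \<open>D'\<close> raises the weight by one. This is carried
  along monomials so that \<open>S k\<close> can be evaluated on \<open>x\<close>,
  \<open>D x\<close> and \<open>D' x\<close> in the commutation proof.\<close>

definition wtD :: "int \<Rightarrow> pspace \<Rightarrow> bool" where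
  "wtD w x \<longleftrightarrow> wt m l w x \<and> wt m l (w - 1) (D x) \<and> wt m l (w + 1) (D' x)"

lemma wtD_zv:
  assumes "wtD w x"
  shows "wtD (w + 1) (pmul zv x)"
proof -
  have w: "wt m l w x" "wt m l (w - 1) (D x)" "wt m l (w + 1) (D' x)"
    using assms by (auto simp: wtD_def)
  have "wt m l w (pmul zv (D x))" "wt m l (w + 2) (pmul zv (D' x))"
    using wt_zv[OF w(2)] wt_zv[OF w(3)] by (simp_all add: algebra_simps)
  moreover have "wt m l w (S 0 x)"
    by (rule wt_S[OF w(1)]) (metis add_0_right dvd_add)
  moreover have "wt m l (w + 2) (S 1 x)"
  proof (rule wt_S[OF w(1)])
    \<comment> \<open>The weights \<open>- w\<close> and \<open>w + 2\<close> differ by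
      \<open>2 (w + 1)\<close>.\<close>
    assume "int m dvd w + 1"
    then have "int m dvd 2 * (w + 1)" by (rule dvd_mult)
    then show "int m dvd w + (w + 2)" by (simp add: ring_distribs)
  qed
  ultimately show ?thesis
    using wt_zv[OF w(1)] w(1) unfolding wtD_def dunkl_zv dunklb_zv
    by (auto intro!: wt_add wt_diff wt_pscale simp: add.commute)
qed

lemma wtD_zbv:
  assumes "wtD w x"
  shows "wtD (w - 1) (pmul zbv x)"
proof -
  have w: "wt m l w x" "wt m l (w - 1) (D x)" "wt m l (w + 1) (D' x)"
    using assms by (auto simp: wtD_def)
  have "wt m l (w - 2) (pmul zbv (D x))" "wt m l w (pmul zbv (D' x))"
    using wt_zbv[OF w(2)] wt_zbv[OF w(3)] by (simp_all add: algebra_simps)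
  moreover have "wt m l w (S 0 x)"
    by (rule wt_S[OF w(1)]) (metis add_0_right dvd_add)
  moreover have "wt m l (w - 2) (S (- 1) x)"
  proof (rule wt_S[OF w(1)])
    assume "int m dvd w + - 1"
    then have "int m dvd 2 * (w - 1)" by (intro dvd_mult) simp
    then show "int m dvd w + (w - 2)" by (simp add: ring_distribs)
  qed
  ultimately show ?thesis
    using wt_zbv[OF w(1)] w(1) unfolding wtD_def dunkl_zbv dunklb_zbv
    by (auto intro!: wt_add wt_diff wt_pscale)
qed

text \<open>Commuting \<open>[D, D']\<close> past \<open>z\<close> leaves \<open>\<kappa> ([S\<^sub>0, D'] + [S\<^sub>1, D])\<close>. On elements of pure weight the
  operators \<open>S\<^sub>k\<close> become multiples of \<open>\<sigma>\<^sub>0\<close>, and the terms cancel because \<open>\<sigma>\<^sub>0 D = D' \<sigma>\<^sub>0\<close>.\<close>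

lemma D_D': "D (D' f) = D' (D f)"
proof (rule pspace_induct_strong[where W = "\<lambda>x. \<exists>w. wtD w x" and P = "\<lambda>f. D (D' f) = D' (D f)"])
  have "wtD (int l) tv" "wtD (- int l) tbv"
    by (simp_all add: wtD_def wt_tv wt_tbv dunkl_tv dunklb_tv wt_0)
  then show "\<exists>w. wtD w tv" "\<exists>w. wtD w tbv"
    by blast+
next
  fix x assume "\<exists>w. wtD w x" and IH: "D (D' x) = D' (D x)"
  then obtain w where w: "wtD w x" by blast
  then have ws: "wt m l w x" "wt m l (w - 1) (D x)" "wt m l (w + 1) (D' x)"
    by (auto simp: wtD_def)
  note S = S_wt[OF ws(1)] S_wt[OF ws(2)] S_wt[OF ws(3)]
  have "D (D' (pmul zv x)) = D' (D (pmul zv x))"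
    unfolding dunkl_simps dunklb_simps operators_minus S IH
    by (simp add: dunkl_simps dunklb_simps pspace_lin sigma0_D sigma0_D' algebra_simps)
  then show "(\<exists>w. wtD w (pmul zv x)) \<and> D (D' (pmul zv x)) = D' (D (pmul zv x))"
    using wtD_zv[OF w] by blast
  have "D (D' (pmul zbv x)) = D' (D (pmul zbv x))"
    unfolding dunkl_simps dunklb_simps operators_minus S IH
    by (simp add: dunkl_simps dunklb_simps pspace_lin sigma0_D sigma0_D' algebra_simps)
  then show "(\<exists>w. wtD w (pmul zbv x)) \<and> D (D' (pmul zbv x)) = D' (D (pmul zbv x))"
    using wtD_zbv[OF w] by blast
qed (simp_all add: dunkl_simps dunklb_simps)

section \<open>The Euler identity\<close>

text \<open>The term \<open>- \<kappa> z' S 1 x\<close> from \<open>z' D' (z x)\<close> cancels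
  \<open>\<kappa> S 0 (z x)\<close>, and \<open>z D (z x)\<close> supplies both the new summand
  \<open>z x\<close> and the term \<open>\<kappa> z S 0 x\<close> of the old identity. The rule for
  \<open>z'\<close> is its mirror image.\<close>

lemma euler_zv:
  assumes "pmul zv (D x) + pmul zbv (D' x) + pscale (of_real \<kappa>) (S 0 x) = pscale c x"
  shows "pmul zv (D (pmul zv x)) + pmul zbv (D' (pmul zv x)) + pscale (of_real \<kappa>) (S 0 (pmul zv x))
    = pscale (c + 1) (pmul zv x)"
proof -
  have "pmul zv (D (pmul zv x)) + pmul zbv (D' (pmul zv x)) + pscale (of_real \<kappa>) (S 0 (pmul zv x))
    = pmul zv x + pmul zv (pmul zv (D x) + pmul zbv (D' x) + pscale (of_real \<kappa>) (S 0 x))"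
    unfolding dunkl_zv dunklb_zv sigsum_zv by (simp add: prod_eq_iff algebra_simps)
  then show ?thesis
    unfolding assms by (simp add: prod_eq_iff algebra_simps)
qed

lemma euler_zbv:
  assumes "pmul zv (D x) + pmul zbv (D' x) + pscale (of_real \<kappa>) (S 0 x) = pscale c x"
  shows "pmul zv (D (pmul zbv x)) + pmul zbv (D' (pmul zbv x)) + pscale (of_real \<kappa>) (S 0 (pmul zbv x))
    = pscale (c + 1) (pmul zbv x)"
proof -
  have "pmul zv (D (pmul zbv x)) + pmul zbv (D' (pmul zbv x)) + pscale (of_real \<kappa>) (S 0 (pmul zbv x))
    = pmul zbv x + pmul zbv (pmul zv (D x) + pmul zbv (D' x) + pscale (of_real \<kappa>) (S 0 x))"
    unfolding dunkl_zbv dunklb_zbv sigsum_zbv by (simp add: prod_eq_iff algebra_simps)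
  then show ?thesis
    unfolding assms by (simp add: prod_eq_iff algebra_simps)
qed

lemma S_0_base: "S 0 tv = 0" "S 0 tbv = 0"
  using nd by (simp_all add: S_wt[OF wt_tv] S_wt[OF wt_tbv] pscale_0)

lemma euler_monom:
  assumes "e = tv \<or> e = tbv"
  shows "pmul zv (D (pmul (zv ^ a * zbv ^ b) e)) + pmul zbv (D' (pmul (zv ^ a * zbv ^ b) e))
      + pscale (of_real \<kappa>) (S 0 (pmul (zv ^ a * zbv ^ b) e))
    = pscale (of_nat (a + b)) (pmul (zv ^ a * zbv ^ b) e)"
    (is "?E a b")
proof (induction a)
  case 0
  show ?case
  proof (induction b)
    case 0
    have "pmul 1 e = e" by (simp add: prod_eq_iff)
    then show ?case
      using assms by (auto simp: S_0_base dunkl_tv dunklb_tv pscale_0 pscale_zero)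
  next
    case (Suc b)
    then have "?E 0 b" by simp
    from euler_zbv[OF this] show ?case
      by (simp add: pmul_def mult.assoc add.commute)
  qed
next
  case (Suc a)
  then have "?E a b" by simp
  from euler_zv[OF this] show ?case
    by (simp add: pmul_def mult.assoc add.commute)
qed

lemma pspace_eq: "f = pmul (fst f) tv + pmul (snd f) tbv"
  by (simp add: prod_eq_iff tv_def tbv_def)

lemma euler:
  assumes "homogeneous n f"
  shows "pmul zv (D f) + pmul zbv (D' f) + pscale (of_real \<kappa>) (S 0 f) = pscale (of_nat n) f"
proof -
  let ?E = "\<lambda>f. pmul zv (D f) + pmul zbv (D' f) + pscale (of_real \<kappa>) (S 0 f) = pscale (of_nat n) f"
  have add: "?E (x + y)" if "?E x" "?E y" for x y
  proof -
    have "pmul zv (D (x + y)) + pmul zbv (D' (x + y)) + pscale (of_real \<kappa>) (S 0 (x + y))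
      = (pmul zv (D x) + pmul zbv (D' x) + pscale (of_real \<kappa>) (S 0 x))
        + (pmul zv (D y) + pmul zbv (D' y) + pscale (of_real \<kappa>) (S 0 y))"
      by (simp add: dunkl_add dunklb_add sigsum_add pspace_lin)
    then show ?thesis using that by (simp add: pscale_add)
  qed
  have *: "?E (pmul p e)" if e: "e = tv \<or> e = tbv" and p: "bhomogeneous n p" for p e
  proof (induction p rule: bpoly_induct)
    case zero
    have "pmul 0 e = 0" by (simp add: prod_eq_iff)
    then show ?case by (simp add: pscale_zero)
  next
    case (add p q)
    have "pmul (p + q) e = pmul p e + pmul q e" by (simp add: prod_eq_iff algebra_simps)
    then show ?case using \<open>\<And>x y. ?E x \<Longrightarrow> ?E y \<Longrightarrow> ?E (x + y)\<close>[OF add] by simp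
  next
    case (monom a b)
    have n: "a + b = n" using p monom by (auto simp: bhomogeneous_def)
    let ?x = "pmul (zv ^ a * zbv ^ b) e" and ?c = "coeff (coeff p a) b"
    have "pmul (const ?c * (zv ^ a * zbv ^ b)) e = pscale ?c ?x"
      by (simp add: prod_eq_iff mult.assoc)
    moreover have "?E (pscale ?c ?x)"
    proof -
      have "pmul zv (D (pscale ?c ?x)) + pmul zbv (D' (pscale ?c ?x)) + pscale (of_real \<kappa>) (S 0 (pscale ?c ?x))
        = pscale ?c (pmul zv (D ?x) + pmul zbv (D' ?x) + pscale (of_real \<kappa>) (S 0 ?x))"
        by (simp add: dunkl_pscale dunklb_pscale sigsum_pscale pspace_lin mult.commute)
      then show ?thesis
        unfolding euler_monom[OF e] n by (simp add: pspace_lin mult.commute)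
    qed
    ultimately show ?case by simp
  qed
  show ?thesis
    using add[OF *[of tv "fst f"] *[of tbv "snd f"]] assms
    unfolding pspace_eq[symmetric] homogeneous_def by simp
qed

end

section \<open>Harmonic polynomials\<close>

lemma coeff_zv_mult: "coeff (zv * p) 0 = 0" "coeff (zv * p) (Suc a) = coeff p a"
  by (simp_all add: zv_mult)

lemma coeff_zbv_mult:
  "coeff (coeff (zbv * p) a) 0 = 0" "coeff (coeff (zbv * p) a) (Suc b) = coeff (coeff p a) b"
  by (simp_all add: zbv_mult)

lemma bhomogeneous_zv: "bhomogeneous (Suc n) (zv * p) \<longleftrightarrow> bhomogeneous n p"
proof -
  have "coeff (coeff (zv * p) a) b \<noteq> 0 \<longleftrightarrow> (\<exists>a'. a = Suc a' \<and> coeff (coeff p a') b \<noteq> 0)" for a b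
    by (cases a) (simp_all add: coeff_zv_mult)
  then show ?thesis unfolding bhomogeneous_def by (metis add_Suc nat.inject)
qed

lemma bhomogeneous_zbv: "bhomogeneous (Suc n) (zbv * p) \<longleftrightarrow> bhomogeneous n p"
proof -
  have "coeff (coeff (zbv * p) a) b \<noteq> 0 \<longleftrightarrow> (\<exists>b'. b = Suc b' \<and> coeff (coeff p a) b' \<noteq> 0)" for a b
    by (cases b) (simp_all add: coeff_zbv_mult)
  then show ?thesis unfolding bhomogeneous_def by (metis add_Suc_right nat.inject)
qed

lemma bhomogeneous_add: "bhomogeneous n p \<Longrightarrow> bhomogeneous n q \<Longrightarrow> bhomogeneous n (p + q)"
  by (force simp: bhomogeneous_def)

lemma bhomogeneous_const_mult: "bhomogeneous n p \<Longrightarrow> bhomogeneous n (const c * p)"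
  by (auto simp: bhomogeneous_def const_mult)

lemma homogeneous_add: "homogeneous n x \<Longrightarrow> homogeneous n y \<Longrightarrow> homogeneous n (x + y)"
  and homogeneous_pscale: "homogeneous n x \<Longrightarrow> homogeneous n (pscale c x)"
  and homogeneous_zv: "homogeneous (Suc n) (pmul zv x) \<longleftrightarrow> homogeneous n x"
  and homogeneous_zbv: "homogeneous (Suc n) (pmul zbv x) \<longleftrightarrow> homogeneous n x"
  by (simp_all add: homogeneous_def bhomogeneous_add bhomogeneous_const_mult bhomogeneous_zv
      bhomogeneous_zbv)

lemma homogeneous_zz:
  "homogeneous (Suc (Suc n)) (pmul (zv * zbv) x) \<longleftrightarrow> homogeneous n x"
  by (simp add: homogeneous_def bhomogeneous_zv bhomogeneous_zbv mult.assoc)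

lemma homogeneous_zz_low:
  assumes "homogeneous n (pmul (zv * zbv) x)" "n < 2"
  shows "x = 0"
proof -
  have "p = 0" if "bhomogeneous n (zv * zbv * p)" for p
  proof (rule ccontr)
    assume "p \<noteq> 0"
    then obtain a b where "coeff (coeff p a) b \<noteq> 0"
      by (metis coeff_0 poly_eqI)
    then have "coeff (coeff (zv * zbv * p) (Suc a)) (Suc b) \<noteq> 0"
      by (simp add: mult.assoc coeff_zv_mult coeff_zbv_mult)
    then show False
      using that assms(2) unfolding bhomogeneous_def by fastforce
  qed
  then show ?thesis
    using assms by (simp add: homogeneous_def prod_eq_iff)
qed

lemma homogeneous_zz_power:
  "homogeneous n x \<Longrightarrow> homogeneous (n + 2 * s) (pmul ((zv * zbv) ^ s) x)"
proof (induction s)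
  case (Suc s)
  have "pmul ((zv * zbv) ^ Suc s) x = pmul (zv * zbv) (pmul ((zv * zbv) ^ s) x)"
    by (simp add: prod_eq_iff mult.assoc)
  then show ?case using Suc by (simp add: homogeneous_zz)
qed (simp add: pmul_def)

text \<open>Every monomial of degree \<open>n\<close> other than \<open>z^n\<close> and
  \<open>z'^n\<close> contains both variables.\<close>

lemma zz_dvdI:
  assumes p: "bhomogeneous n p" and 0: "coeff (coeff p n) 0 = 0" "coeff (coeff p 0) n = 0"
  shows "zv * zbv dvd p"
proof -
  have "coeff p 0 = 0"
  proof (rule poly_eqI)
    fix b show "coeff (coeff p 0) b = coeff 0 b"
      using p 0(2) by (cases "b = n") (simp, metis add_0 bhomogeneous_def coeff_0)
  qed
  then obtain p' where p': "p = zv * p'"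
    by (cases p) (auto simp: zv_mult)
  have "[:0, 1:] dvd coeff p' a" for a
  proof -
    have "coeff (coeff p (Suc a)) 0 = 0"
      using p 0(1) by (cases "Suc a = n") (force simp: bhomogeneous_def)+
    then have "poly (coeff p' a) 0 = 0"
      by (simp add: p' coeff_zv_mult poly_0_coeff_0)
    then show ?thesis
      by (simp add: poly_eq_0_iff_dvd)
  qed
  then have "zbv dvd p'"
    by (simp add: zbv_def const_poly_dvd_iff)
  then show ?thesis
    by (simp add: p')
qed

lemma pmul_eq_0_iff: "pmul g x = 0 \<longleftrightarrow> g = 0 \<or> x = 0"
  by (auto simp: prod_eq_iff)

lemma zz_nz: "zv * zbv \<noteq> 0"
  by (simp add: zv_def zbv_def)

context dihedral
begin

section \<open>The Laplacian on multiples of \<open>z z'\<close>\<close>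

text \<open>Since \<open>z z'\<close> is invariant under all reflections, the difference terms
  cancel and \<open>D\<close>, \<open>D'\<close> differentiate this factor in the ordinary way. What
  remains of first order is \<open>g\<close> plus the Euler operator applied to
  \<open>g\<close>.\<close>

lemma laplace_zz:
  assumes "homogeneous n g"
  shows "D (D' (pmul (zv * zbv) g)) = pscale (of_nat (n + 1)) g + pmul (zv * zbv) (D (D' g))"
proof -
  have 1: "D' (pmul (zv * zbv) g) = pmul zv g + pmul zv (pmul zbv (D' g))"
  proof -
    have "pmul (zv * zbv) g = pmul zv (pmul zbv g)" by (simp add: prod_eq_iff mult.assoc)
    then show ?thesis
      by (simp only: dunklb_simps sigsum_zbv) (simp add: prod_eq_iff algebra_simps)
  qed
  have 2: "D (pmul zv (pmul zbv h)) = pmul zbv h + pmul zv (pmul zbv (D h))" for h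
    by (simp only: dunkl_simps sigsum_zbv) (simp add: prod_eq_iff algebra_simps)
  have "D (D' (pmul (zv * zbv) g))
    = g + (pmul zv (D g) + pmul zbv (D' g) + pscale (of_real \<kappa>) (S 0 g)) + pmul (zv * zbv) (D (D' g))"
    unfolding 1 dunkl_add 2 unfolding dunkl_zv by (simp add: prod_eq_iff algebra_simps)
  then show ?thesis
    unfolding euler[OF assms] by (simp add: prod_eq_iff algebra_simps)
qed

text \<open>The factors \<open>z z'\<close> are added one at a time; the increments
  \<open>n + 1\<close>, \<open>n + 3\<close>, ..., \<open>n + 2 s + 1\<close> sum to the stated
  coefficient.\<close>

lemma laplace_zz_power:
  assumes "homogeneous n h"
  shows "D (D' (pmul ((zv * zbv) ^ Suc s) h))
    = pscale (of_nat (Suc s * (n + Suc s))) (pmul ((zv * zbv) ^ s) h) + pmul ((zv * zbv) ^ Suc s) (D (D' h))"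
proof (induction s)
  case 0
  show ?case
    using laplace_zz[OF assms] by (simp add: pmul_def)
next
  case (Suc s)
  let ?x = "pmul ((zv * zbv) ^ Suc s) h"
  have "pmul ((zv * zbv) ^ Suc (Suc s)) h = pmul (zv * zbv) ?x"
    by (simp add: prod_eq_iff mult.assoc)
  then have "D (D' (pmul ((zv * zbv) ^ Suc (Suc s)) h))
    = pscale (of_nat (n + 2 * Suc s + 1)) ?x + pmul (zv * zbv) (D (D' ?x))"
    using laplace_zz[OF homogeneous_zz_power[OF assms, of "Suc s"]] by simp
  also have "\<dots> = pscale (of_nat (n + 2 * Suc s + 1)) ?x
      + (pscale (of_nat (Suc s * (n + Suc s))) ?x + pmul ((zv * zbv) ^ Suc (Suc s)) (D (D' h)))"
    unfolding Suc by (simp add: prod_eq_iff algebra_simps)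
  also have "\<dots> = pscale (of_nat (n + 2 * Suc s + 1) + of_nat (Suc s * (n + Suc s))) ?x
      + pmul ((zv * zbv) ^ Suc (Suc s)) (D (D' h))"
    by (simp only: pspace.scale_left_distrib add.assoc)
  also have "of_nat (n + 2 * Suc s + 1) + of_nat (Suc s * (n + Suc s))
      = (of_nat (Suc (Suc s) * (n + Suc (Suc s))) :: complex)"
    unfolding of_nat_add[symmetric] by (rule arg_cong[where f = of_nat]) (simp add: algebra_simps)
  finally show ?case .
qed

text \<open>If \<open>(z z')^(s+1) h\<close> is harmonic, then \<open>z z'\<close> divides \<open>h\<close>; now descend on the degree.\<close>

lemma laplace_inj:
  assumes "homogeneous n h" "D (D' (pmul ((zv * zbv) ^ Suc s) h)) = 0"
  shows "h = 0"
  using assms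
proof (induction n arbitrary: h s rule: less_induct)
  case (less n)
  define c :: complex where "c = of_nat (Suc s * (n + Suc s))"
  have c: "c \<noteq> 0"
    unfolding c_def of_nat_eq_0_iff by simp
  have "pmul ((zv * zbv) ^ s) (pscale c h + pmul (zv * zbv) (D (D' h))) = 0"
    using less.prems unfolding laplace_zz_power[OF less.prems(1)] c_def
    by (simp add: prod_eq_iff algebra_simps)
  then have eq: "pscale c h + pmul (zv * zbv) (D (D' h)) = 0"
    using zz_nz by (simp add: pmul_eq_0_iff)
  \<comment> \<open>The equation just obtained, solved for \<open>h\<close>.\<close>
  define h' where "h' = pscale (- inverse c) (D (D' h))"
  have "pmul (zv * zbv) h' = pscale (- inverse c) (pscale c h + pmul (zv * zbv) (D (D' h)))
      + pscale (inverse c * c) h"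
    by (simp add: h'_def prod_eq_iff const_minus algebra_simps)
  then have h: "h = pmul (zv * zbv) h'"
    unfolding eq using c by (simp add: pscale_1 pscale_zero)
  have "h' = 0"
  proof (cases "n < 2")
    case True
    then show ?thesis using homogeneous_zz_low less.prems(1) h by metis
  next
    case False
    then obtain k where n: "n = Suc (Suc k)"
      by (metis less_2_cases_iff not0_implies_Suc One_nat_def)
    \<comment> \<open>The degree drops by two while the exponent grows by one, which is why
      \<open>s\<close> is arbitrary in the induction.\<close>
    have "pmul ((zv * zbv) ^ Suc s) h = pmul ((zv * zbv) ^ Suc (Suc s)) h'"
      unfolding h by (simp add: prod_eq_iff ac_simps)
    then have "D (D' (pmul ((zv * zbv) ^ Suc (Suc s)) h')) = 0"
      using less.prems(2) by (simp only:)
    moreover have "homogeneous k h'"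
      using less.prems(1) homogeneous_zz unfolding h n by simp
    ultimately show ?thesis
      using n by (intro less.IH[of k h' "Suc s"]) simp_all
  qed
  then show ?case using h by simp
qed

text \<open>Without its \<open>z^n\<close> and \<open>z'^n\<close> terms a form of degree
  \<open>n\<close> is a multiple of \<open>z z'\<close>, and \<open>laplace_inj\<close> with
  \<open>s = 0\<close> applies.\<close>

lemma harmonic_eq_0I:
  assumes f: "f \<in> harmonics m l \<kappa> n"
    and "coeff (coeff (fst f) n) 0 = 0" "coeff (coeff (fst f) 0) n = 0"
    and "coeff (coeff (snd f) n) 0 = 0" "coeff (coeff (snd f) 0) n = 0"
  shows "f = 0"
proof -
  have hom: "homogeneous n f" and har: "D (D' f) = 0"
    using f by (auto simp: harmonics_def harmonic_def)
  obtain g1 g2 where "fst f = zv * zbv * g1" "snd f = zv * zbv * g2"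
    using zz_dvdI[of n "fst f"] zz_dvdI[of n "snd f"] hom assms unfolding homogeneous_def dvd_def by blast
  then have fg: "f = pmul (zv * zbv) (g1, g2)"
    by (simp add: prod_eq_iff)
  have "(g1, g2) = 0"
  proof (cases "n < 2")
    case True
    then show ?thesis using homogeneous_zz_low hom fg by metis
  next
    case False
    then obtain k where n: "n = Suc (Suc k)"
      by (metis less_2_cases_iff not0_implies_Suc One_nat_def)
    show ?thesis
      using laplace_inj[of k "(g1, g2)" 0] hom har homogeneous_zz unfolding fg n by simp
  qed
  then show ?thesis using fg by simp
qed

end

section \<open>The Hermitian form\<close>

context dihedral
begin

lemma funpow_D_lin:
  "(D ^^ a) (x + y) = (D ^^ a) x + (D ^^ a) y" "(D ^^ a) (pscale c x) = pscale c ((D ^^ a) x)"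
  "(D' ^^ a) (x + y) = (D' ^^ a) x + (D' ^^ a) y" "(D' ^^ a) (pscale c x) = pscale c ((D' ^^ a) x)"
  by (induction a) (simp_all add: dunkl_add dunkl_pscale dunklb_add dunklb_pscale)

lemma D_funpow_D': "D ((D' ^^ b) x) = (D' ^^ b) (D x)"
  by (induction b) (simp_all add: D_D')

definition starterm :: "nat \<Rightarrow> nat \<Rightarrow> complex \<Rightarrow> pspace \<Rightarrow> pspace" where
  "starterm a b c q = pscale (cnj c * 2 ^ (a + b)) ((D ^^ a) ((D' ^^ b) q))"

abbreviation star where "star \<equiv> star_op m l \<kappa>"
abbreviation ip where "ip \<equiv> form m l \<kappa>"

lemma starterm_0 [simp]: "starterm a b 0 q = 0"
  by (simp add: starterm_def pscale_0)

lemma starterm_add: "starterm a b (c + d) q = starterm a b c q + starterm a b d q"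
  by (simp add: starterm_def prod_eq_iff algebra_simps)

lemma starterm_mult: "starterm a b (c * d) q = pscale (cnj c) (starterm a b d q)"
  by (simp add: starterm_def pscale_pscale mult.assoc del: const_simps)

lemma starterm_add_right: "starterm a b c (x + y) = starterm a b c x + starterm a b c y"
  by (simp add: starterm_def funpow_D_lin pscale_add)

lemma starterm_pscale_right: "starterm a b c (pscale d x) = pscale d (starterm a b c x)"
  by (simp add: starterm_def funpow_D_lin pscale_pscale mult.commute)

text \<open>The extra \<open>D\<close> has to pass the powers of \<open>D'\<close> to reach
  \<open>q\<close>, which uses \<open>D_D'\<close>.\<close>

lemma starterm_Suc_left: "starterm (Suc a) b c q = pscale 2 (starterm a b c (D q))"
  by (simp add: starterm_def pscale_pscale funpow_swap1 D_funpow_D')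

lemma starterm_Suc_right: "starterm a (Suc b) c q = pscale 2 (starterm a b c (D' q))"
  by (simp add: starterm_def pscale_pscale funpow_swap1)

text \<open>The upper summation bounds in \<open>star_op\<close> depend on the polynomial; any larger box gives the
  same value.\<close>

lemma star_box:
  obtains N where "\<And>M K q. M \<ge> N \<Longrightarrow> K \<ge> N \<Longrightarrow>
    star p q = (\<Sum>a<M. \<Sum>b<K. starterm a b (coeff (coeff p a) b) q)"
proof
  fix M K q
  let ?N = "Suc (degree p + (\<Sum>a\<le>degree p. degree (coeff p a)))"
  assume M: "M \<ge> ?N" and K: "K \<ge> ?N"
  have inner: "(\<Sum>b\<le>degree (coeff p a). starterm a b (coeff (coeff p a) b) q)
     = (\<Sum>b<K. starterm a b (coeff (coeff p a) b) q)" if "a \<le> degree p" for a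
  proof (rule sum.mono_neutral_left)
    have "degree (coeff p a) \<le> (\<Sum>a\<le>degree p. degree (coeff p a))"
      using that by (intro member_le_sum) auto
    then show "{..degree (coeff p a)} \<subseteq> {..<K}"
      using K by auto
    show "\<forall>b\<in>{..<K} - {..degree (coeff p a)}. starterm a b (coeff (coeff p a) b) q = 0"
      by (auto simp: coeff_eq_0)
  qed simp
  have "star p q = (\<Sum>a\<le>degree p. \<Sum>b<K. starterm a b (coeff (coeff p a) b) q)"
    unfolding star_op_def starterm_def[symmetric] using inner by simp
  also have "\<dots> = (\<Sum>a<M. \<Sum>b<K. starterm a b (coeff (coeff p a) b) q)"
    using M by (intro sum.mono_neutral_left) (auto simp: coeff_eq_0)
  finally show "star p q = \<dots>" .
qed

lemma star_add: "star (p + p') q = star p q + star p' q"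
proof -
  obtain N1 where N1: "\<And>M K q. M \<ge> N1 \<Longrightarrow> K \<ge> N1 \<Longrightarrow>
    star p q = (\<Sum>a<M. \<Sum>b<K. starterm a b (coeff (coeff p a) b) q)" by (rule star_box) blast
  obtain N2 where N2: "\<And>M K q. M \<ge> N2 \<Longrightarrow> K \<ge> N2 \<Longrightarrow>
    star p' q = (\<Sum>a<M. \<Sum>b<K. starterm a b (coeff (coeff p' a) b) q)" by (rule star_box) blast
  obtain N3 where N3: "\<And>M K q. M \<ge> N3 \<Longrightarrow> K \<ge> N3 \<Longrightarrow>
    star (p + p') q = (\<Sum>a<M. \<Sum>b<K. starterm a b (coeff (coeff (p + p') a) b) q)" by (rule star_box) blast
  let ?N = "max N1 (max N2 N3)"
  show ?thesis
    by (simp add: N1[of ?N ?N] N2[of ?N ?N] N3[of ?N ?N] starterm_add sum.distrib)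
qed

lemma coeff_const_mult: "coeff (coeff (const c * p) a) b = c * coeff (coeff p a) b"
  by (simp add: const_mult)

lemma star_const_mult: "star (const c * p) q = pscale (cnj c) (star p q)"
proof -
  obtain N1 where N1: "\<And>M K q. M \<ge> N1 \<Longrightarrow> K \<ge> N1 \<Longrightarrow>
    star p q = (\<Sum>a<M. \<Sum>b<K. starterm a b (coeff (coeff p a) b) q)" by (rule star_box) blast
  obtain N2 where N2: "\<And>M K q. M \<ge> N2 \<Longrightarrow> K \<ge> N2 \<Longrightarrow>
    star (const c * p) q = (\<Sum>a<M. \<Sum>b<K. starterm a b (coeff (coeff (const c * p) a) b) q)"
    by (rule star_box) blast
  let ?N = "max N1 N2"
  show ?thesis
    by (simp add: N1[of ?N ?N] N2[of ?N ?N] coeff_const_mult starterm_mult pscale_sum)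
qed

lemma star_add_right: "star p (x + y) = star p x + star p y"
  by (simp add: star_op_def starterm_def[symmetric] starterm_add_right sum.distrib)

lemma star_pscale_right: "star p (pscale c x) = pscale c (star p x)"
  by (simp add: star_op_def starterm_def[symmetric] starterm_pscale_right pscale_sum)

lemma star_zv: "star (zv * p) q = pscale 2 (star p (D q))"
proof -
  obtain N1 where N1: "\<And>M K q. M \<ge> N1 \<Longrightarrow> K \<ge> N1 \<Longrightarrow>
    star p q = (\<Sum>a<M. \<Sum>b<K. starterm a b (coeff (coeff p a) b) q)" by (rule star_box) blast
  obtain N2 where N2: "\<And>M K q. M \<ge> N2 \<Longrightarrow> K \<ge> N2 \<Longrightarrow>
    star (zv * p) q = (\<Sum>a<M. \<Sum>b<K. starterm a b (coeff (coeff (zv * p) a) b) q)"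
    by (rule star_box) blast
  let ?N = "max N1 N2"
  \<comment> \<open>Multiplication by \<open>z\<close> shifts the coefficients, so the box for the
    product is one longer in that direction and its first row is zero.\<close>
  show ?thesis
    by (simp add: N1[of ?N ?N] N2[of "Suc ?N" ?N] sum.lessThan_Suc_shift coeff_zv_mult
        starterm_Suc_left pscale_sum del: sum.lessThan_Suc)
qed

lemma star_zbv: "star (zbv * p) q = pscale 2 (star p (D' q))"
proof -
  obtain N1 where N1: "\<And>M K q. M \<ge> N1 \<Longrightarrow> K \<ge> N1 \<Longrightarrow>
    star p q = (\<Sum>a<M. \<Sum>b<K. starterm a b (coeff (coeff p a) b) q)" by (rule star_box) blast
  obtain N2 where N2: "\<And>M K q. M \<ge> N2 \<Longrightarrow> K \<ge> N2 \<Longrightarrow>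
    star (zbv * p) q = (\<Sum>a<M. \<Sum>b<K. starterm a b (coeff (coeff (zbv * p) a) b) q)"
    by (rule star_box) blast
  let ?N = "max N1 N2"
  show ?thesis
    by (simp add: N1[of ?N ?N] N2[of ?N "Suc ?N"] sum.lessThan_Suc_shift coeff_zbv_mult
        starterm_Suc_right pscale_sum del: sum.lessThan_Suc)
qed

lemma ip_eq: "ip p q = 2 * (coeff (coeff (fst (star (fst p) q)) 0) 0 + coeff (coeff (snd (star (snd p) q)) 0) 0)"
  by (simp add: form_def tform_def at_zero_def)

lemma ip_add_left: "ip (x + y) q = ip x q + ip y q"
  and ip_pscale_left: "ip (pscale c x) q = cnj c * ip x q"
  and ip_add_right: "ip x (p + q) = ip x p + ip x q"
  and ip_pscale_right: "ip x (pscale c q) = c * ip x q"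
  and ip_zv: "ip (pmul zv x) q = 2 * ip x (D q)"
  and ip_zbv: "ip (pmul zbv x) q = 2 * ip x (D' q)"
  by (simp_all add: ip_eq star_add star_const_mult star_add_right star_pscale_right star_zv star_zbv
      coeff_const_mult algebra_simps)

lemma ip_tv: "ip tv q = 2 * coeff (coeff (fst q) 0) 0"
  and ip_tbv: "ip tbv q = 2 * coeff (coeff (snd q) 0) 0"
  by (simp_all add: ip_eq tv_def tbv_def star_op_def pscale_1 pscale_0)

lemmas ip_simps = ip_add_left ip_pscale_left ip_add_right ip_pscale_right

section \<open>The harmonic polynomials obtained by repeated multiplication by z\<close>

text \<open>\<open>quo e w n\<close> is the quotient \<open>p\<^sub>(\<^sub>n\<^sub>+\<^sub>1\<^sub>) / z\<close> for the sequence starting with \<open>p\<^sub>1 = z e\<close>, where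
  \<open>e\<close> is \<open>t\<close> or \<open>t'\<close> and has weight \<open>w\<close>.\<close>

primrec quo :: "pspace \<Rightarrow> int \<Rightarrow> nat \<Rightarrow> pspace" where
  "quo e w 0 = e"
| "quo e w (Suc n) = (if int m dvd w + int (Suc n)
     then pmul zv (quo e w n) + pscale (of_real (real m * \<kappa> / real (Suc n))) (sigma0 (pmul zv (quo e w n)))
     else pmul zv (quo e w n))"

lemma pol1_Suc: "pol1 m l \<kappa> (Suc n) = pmul zv (quo tv (int l) n)"
proof (induction n)
  case (Suc n)
  have "[int (Suc n) + int l = 0] (mod int m) \<longleftrightarrow> int m dvd int l + int (Suc n)"
    by (simp add: cong_0_iff add.commute)
  then show ?case using Suc by simp
qed simp

lemma pol2_Suc: "pol2 m l \<kappa> (Suc n) = pmul zv (quo tbv (- int l) n)"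
proof (induction n)
  case (Suc n)
  have "[int (Suc n) - int l = 0] (mod int m) \<longleftrightarrow> int m dvd - int l + int (Suc n)"
    by (simp add: cong_0_iff)
  then show ?case using Suc by simp
qed simp

text \<open>Both families are treated at once through the admissible pairs of initial form and
  weight.\<close>

definition start :: "pspace \<Rightarrow> int \<Rightarrow> bool" where
  "start e w \<longleftrightarrow> e = tv \<and> w = int l \<or> e = tbv \<and> w = - int l"

lemma const_2: "const 2 = 2"
  using const_simps(3)[of 1 1] by simp

text \<open>The three claims support each other. Put \<open>q = quo e w n\<close>,
  \<open>p = z q\<close>. At a twisted step \<open>D' p = - \<kappa> m sigma0 q\<close>, while
  \<open>D' (sigma0 p) = sigma0 (D p) = (n + 1) sigma0 q\<close>; the coefficient \<open>c\<close>
  of the recursion is the one for which \<open>D' (p + c sigma0 p) = 0\<close>.\<close>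

lemma quo_props:
  assumes "start e w"
  shows "wt m l (w + int n) (quo e w n) \<and> D' (quo e w n) = 0
    \<and> D (pmul zv (quo e w n)) = pscale (of_nat (Suc n)) (quo e w n)"
proof (induction n)
  case 0
  then show ?case
    using assms nd by (auto simp: start_def wt_tv wt_tbv dunkl_zv dunkl_tv dunklb_tv S_0_base
        pscale_zero pscale_1)
next
  case (Suc n)
  let ?q = "quo e w n"
  define p where "p = pmul zv ?q"
  have wq: "wt m l (w + int n) ?q" and D'q: "D' ?q = 0" and Dp: "D p = pscale (of_nat (Suc n)) ?q"
    using Suc by (auto simp: p_def)
  have wp: "wt m l (w + int (Suc n)) p"
    using wt_zv[OF wq] by (simp add: p_def algebra_simps)
  have D'p: "D' p = - pscale (of_real \<kappa>) (S 1 ?q)"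
    by (simp add: p_def dunklb_zv D'q)
  show ?case
  proof (cases "int m dvd w + int (Suc n)")
    case False
    then have q: "quo e w (Suc n) = p" by (simp add: p_def)
    have "S 1 ?q = 0"
      using False by (simp add: S_wt[OF wq] algebra_simps pscale_0)
    then have "D' p = 0"
      by (simp add: D'p pscale_zero)
    moreover have "D (pmul zv p) = pscale (of_nat (Suc (Suc n))) p"
    proof -
      have "S 0 p = 0" using False by (simp add: S_wt[OF wp] pscale_0)
      then have "D (pmul zv p) = p + pscale (of_nat (Suc n)) (pmul zv ?q)"
        unfolding dunkl_zv Dp by (simp add: pscale_zero pmul_pscale)
      then show ?thesis unfolding p_def[symmetric] by (simp add: prod_eq_iff algebra_simps const_2)
    qed
    ultimately show ?thesis using wp q by simp
  next
    case True
    define c :: complex where "c = of_real (real m * \<kappa> / real (Suc n))"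
    have cn: "c * of_nat (Suc n) = of_real \<kappa> * of_nat m"
      by (simp add: c_def field_simps del: of_nat_Suc)
    have q: "quo e w (Suc n) = p + pscale c (sigma0 p)"
      using True by (simp add: p_def c_def)
    \<comment> \<open>At a twisted step the weight of \<open>p\<close> is zero modulo
      \<open>m\<close>, hence equal to its negative.\<close>
    have "wt m l (w + int (Suc n)) (sigma0 p)"
      by (rule wt_cong[OF wt_sigma0[OF wp]])
        (use True in \<open>metis diff_conv_add_uminus dvd_diff dvd_minus_iff\<close>)
    then have wf: "wt m l (w + int (Suc n)) (p + pscale c (sigma0 p))"
      using wp by (intro wt_add wt_pscale)
    have S1: "S 1 ?q = pscale (of_nat m) (sigma0 ?q)"
      using True by (simp add: S_wt[OF wq] algebra_simps)
    have D'p': "D' p = - pscale (of_real \<kappa> * of_nat m) (sigma0 ?q)"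
      unfolding D'p S1 pscale_pscale ..
    have D'f: "D' (p + pscale c (sigma0 p)) = 0"
      unfolding dunklb_add dunklb_pscale sigma0_D[symmetric] Dp D'p' sigma0_pscale pscale_pscale cn
      by simp
    have Df: "D (p + pscale c (sigma0 p))
        = pscale (of_nat (Suc n)) ?q - pscale (c * (c * of_nat (Suc n))) ?q"
      unfolding dunkl_add dunkl_pscale sigma0_D'[symmetric] Dp D'p' cn operators_minus
      by (simp add: sigma0_pscale pspace_lin prod_eq_iff mult.assoc)
    have zDf: "pmul zv (D (p + pscale c (sigma0 p)))
        = pscale (of_nat (Suc n)) p - pscale (c * (c * of_nat (Suc n))) p"
      unfolding Df unfolding p_def by (simp add: prod_eq_iff algebra_simps del: const_simps of_nat_Suc)
    \<comment> \<open>The summand \<open>c^2 (n + 1) p\<close> contained here cancels the negative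
      one in \<open>zDf\<close>.\<close>
    have S0: "pscale (of_real \<kappa>) (S 0 (p + pscale c (sigma0 p)))
        = pscale (c * of_nat (Suc n)) (sigma0 p + pscale c p)"
      using True unfolding S_wt[OF wf] cn by (simp add: sigma0_simps pscale_pscale)
    have "D (pmul zv (p + pscale c (sigma0 p))) = pscale (of_nat (Suc (Suc n))) (p + pscale c (sigma0 p))"
      unfolding dunkl_zv zDf S0 by (simp add: prod_eq_iff algebra_simps const_2)
    then show ?thesis using q wf D'f by simp
  qed
qed


lemmas wt_quo = quo_props[THEN conjunct1]
  and dunklb_quo = quo_props[THEN conjunct2, THEN conjunct1]
  and dunkl_zv_quo = quo_props[THEN conjunct2, THEN conjunct2]

text \<open>The factor in \<open>D' p = - mk sigma0 q\<close> for \<open>p = z q\<close>; it is zero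
  off the twisted steps.\<close>

definition mk :: "int \<Rightarrow> nat \<Rightarrow> complex" where
  "mk w n = (if int m dvd w + int (Suc n) then of_real (real m * \<kappa>) else 0)"

lemma dunklb_zv_quo:
  assumes "start e w"
  shows "D' (pmul zv (quo e w n)) = pscale (- mk w n) (sigma0 (quo e w n))"
proof -
  have "D' (pmul zv (quo e w n)) = - pscale (of_real \<kappa>) (S 1 (quo e w n))"
    by (simp add: dunklb_zv dunklb_quo[OF assms])
  also have "S 1 (quo e w n) = pscale (if int m dvd w + int (Suc n) then of_nat m else 0) (sigma0 (quo e w n))"
    unfolding S_wt[OF wt_quo[OF assms]] by (simp add: ac_simps)
  also have "- pscale (of_real \<kappa>) \<dots> = pscale (- mk w n) (sigma0 (quo e w n))"
    unfolding mk_def pscale_pscale pscale_uminus by (simp add: mult.commute)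
  finally show ?thesis .
qed

section \<open>Scalar products along the two sequences\<close>

text \<open>The outer factor \<open>z\<close> or \<open>z'\<close> on the left moves to the right as
  \<open>2 D\<close> or \<open>2 D'\<close>, whose values on \<open>z q\<close> and its flip are
  known. As \<open>x\<close> is arbitrary, this serves both norms and products between the
  families.\<close>

lemma ip_zv_quo:
  assumes "start e w"
  shows "ip (pmul zv x) (pmul zv (quo e w n)) = 2 * of_nat (Suc n) * ip x (quo e w n)"
    and "ip (pmul zv x) (sigma0 (pmul zv (quo e w n))) = - 2 * mk w n * ip x (quo e w n)"
    and "ip (sigma0 (pmul zv x)) (pmul zv (quo e w n)) = - 2 * mk w n * ip (sigma0 x) (sigma0 (quo e w n))"
    and "ip (sigma0 (pmul zv x)) (sigma0 (pmul zv (quo e w n)))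
      = 2 * of_nat (Suc n) * ip (sigma0 x) (sigma0 (quo e w n))"
  unfolding ip_zv sigma0_zv[of x] ip_zbv sigma0_D'[symmetric] sigma0_D[symmetric]
    dunkl_zv_quo[OF assms] dunklb_zv_quo[OF assms] sigma0_pscale sigma0_sigma0 ip_simps
  by (simp_all del: of_nat_Suc)

text \<open>The flipped product is included because the reduction rules lead from one kind of
  product to the other.\<close>

lemma quo_orth:
  "ip (quo tv (int l) n) (quo tbv (- int l) n) = 0
    \<and> ip (sigma0 (quo tv (int l) n)) (sigma0 (quo tbv (- int l) n)) = 0"
proof (induction n)
  case 0
  show ?case by (simp add: sigma0_simps ip_tv ip_tbv) (simp add: tv_def tbv_def)
next
  case (Suc n)
  have st: "start tbv (- int l)" by (simp add: start_def)
  show ?case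
    by (simp add: ip_simps sigma0_add sigma0_pscale ip_zv_quo[OF st] Suc)
qed

definition sqnorm :: "int \<Rightarrow> nat \<Rightarrow> real" where
  "sqnorm w n = 2 ^ Suc n * fact n *
     (\<Prod>i\<in>{i\<in>{1..n}. int m dvd w + int i}. 1 - (real m * \<kappa> / real i)\<^sup>2)"

lemma sqnorm_Suc:
  "sqnorm w (Suc n) = 2 * real (Suc n) * sqnorm w n *
    (if int m dvd w + int (Suc n) then 1 - (real m * \<kappa> / real (Suc n))\<^sup>2 else 1)"
proof -
  have "{i\<in>{1..Suc n}. int m dvd w + int i} = (if int m dvd w + int (Suc n)
      then insert (Suc n) {i\<in>{1..n}. int m dvd w + int i} else {i\<in>{1..n}. int m dvd w + int i})"
    by (auto simp: le_Suc_eq)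
  then show ?thesis
    by (auto simp: sqnorm_def simp del: of_nat_Suc)
qed

lemma ip_quo:
  assumes "start e w"
  shows "ip (quo e w n) (quo e w n) = of_real (sqnorm w n)
    \<and> ip (sigma0 (quo e w n)) (sigma0 (quo e w n)) = of_real (sqnorm w n)"
proof (induction n)
  case 0
  show ?case
    using assms by (auto simp: start_def sigma0_simps ip_tv ip_tbv sqnorm_def)
      (simp_all add: tv_def tbv_def)
next
  case (Suc n)
  let ?q = "quo e w n"
  show ?case
  proof (cases "int m dvd w + int (Suc n)")
    case False
    then show ?thesis
      using Suc by (simp add: ip_zv_quo[OF assms] sqnorm_Suc del: of_nat_Suc)
  next
    case True
    \<comment> \<open>With \<open>a\<close> the common norm of \<open>z q\<close> and its flip, the
      cross products are \<open>- c a\<close>, so the new norm is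
      \<open>a (1 + c^2) - 2 c^2 a = a (1 - c^2)\<close>.\<close>
    define c where "c = real m * \<kappa> / real (Suc n)"
    have mk: "mk w n = of_real c * of_nat (Suc n)"
      using True by (simp add: mk_def c_def del: of_nat_Suc)
    have q: "quo e w (Suc n) = pmul zv ?q + pscale (of_real c) (sigma0 (pmul zv ?q))"
      using True by (simp add: c_def)
    show ?thesis
      using Suc True unfolding q sqnorm_Suc c_def[symmetric]
      by (simp add: ip_simps sigma0_add sigma0_pscale ip_zv_quo[OF assms] mk del: of_nat_Suc)
         (simp add: algebra_simps power2_eq_square del: of_nat_Suc)
  qed
qed

section \<open>Boundary coefficients and the basis property\<close>

text \<open>Together with \<open>leadb\<close>, the four coordinates that determine a harmonic
  polynomial of degree \<open>n\<close> by \<open>harmonic_eq_0I\<close>.\<close>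

definition lead :: "nat \<Rightarrow> pspace \<Rightarrow> complex \<times> complex" where
  "lead n f = (coeff (coeff (fst f) n) 0, coeff (coeff (snd f) n) 0)"

definition leadb :: "nat \<Rightarrow> pspace \<Rightarrow> complex \<times> complex" where
  "leadb n f = (coeff (coeff (fst f) 0) n, coeff (coeff (snd f) 0) n)"

lemma lead_linear:
  "lead n (x + y) = lead n x + lead n y" "leadb n (x + y) = leadb n x + leadb n y"
  "lead n (x - y) = lead n x - lead n y" "leadb n (x - y) = leadb n x - leadb n y"
  "lead n (pscale c x) = (c * fst (lead n x), c * snd (lead n x))"
  "leadb n (pscale c x) = (c * fst (leadb n x), c * snd (leadb n x))"
  by (simp_all add: lead_def leadb_def coeff_const_mult)

lemma lead_mult:
  "lead (Suc n) (pmul zv x) = lead n x" "leadb n (pmul zv x) = (0, 0)"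
  "leadb (Suc n) (pmul zbv x) = leadb n x" "lead n (pmul zbv x) = (0, 0)"
  by (simp_all add: lead_def leadb_def coeff_zv_mult coeff_zbv_mult)

text \<open>The correction at a twisted step is a multiple of \<open>z'\<close>, so it never reaches
  the coefficient of \<open>z^n\<close>; the flip gives the other half.\<close>

lemma lead_quo: "lead n (quo e w n) = lead 0 e \<and> leadb n (sigma0 (quo e w n)) = leadb 0 (sigma0 e)"
  by (induction n) (simp_all add: lead_linear lead_mult sigma0_simps zero_prod_def)

lemma homogeneous_quo:
  assumes "start e w"
  shows "homogeneous n (quo e w n) \<and> homogeneous n (sigma0 (quo e w n))"
proof (induction n)
  case 0
  have "bhomogeneous 0 0" "bhomogeneous 0 1"
    by (auto simp: bhomogeneous_def one_pCons coeff_pCons split: nat.splits)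
  then have h: "homogeneous 0 tv" "homogeneous 0 tbv"
    by (simp_all add: homogeneous_def tv_def tbv_def)
  show ?case
    using assms h by (auto simp: start_def sigma0_simps)
next
  case (Suc n)
  then show ?case
    by (auto simp: sigma0_simps homogeneous_zv homogeneous_zbv intro!: homogeneous_add homogeneous_pscale)
qed

abbreviation P where "P e w n \<equiv> pmul zv (quo e w n)"

lemma P_harmonic:
  assumes "start e w"
  shows "P e w n \<in> harmonics m l \<kappa> (Suc n)" "sigma0 (P e w n) \<in> harmonics m l \<kappa> (Suc n)"
proof -
  have "D (D' (P e w n)) = 0"
    unfolding dunklb_zv_quo[OF assms] dunkl_pscale sigma0_D'[symmetric] dunklb_quo[OF assms]
    by (simp add: pscale_zero)
  moreover have "D (D' (sigma0 (P e w n))) = 0"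
    unfolding sigma0_D[symmetric] sigma0_D'[symmetric] dunkl_zv_quo[OF assms] dunklb_pscale
      dunklb_quo[OF assms] by (simp add: pscale_zero)
  ultimately show "P e w n \<in> harmonics m l \<kappa> (Suc n)" "sigma0 (P e w n) \<in> harmonics m l \<kappa> (Suc n)"
    using homogeneous_quo[OF assms, of n]
    by (simp_all add: harmonics_def harmonic_def sigma0_zv homogeneous_zv homogeneous_zbv)
qed

lemma subspace_harmonics: "pspace.subspace (harmonics m l \<kappa> n)"
  by (rule pspace.subspaceI)
     (auto simp: harmonics_def harmonic_def dunkl_add dunkl_pscale dunklb_add dunklb_pscale pscale_zero
        homogeneous_add homogeneous_pscale, simp add: homogeneous_def bhomogeneous_def)

abbreviation P1 where "P1 n \<equiv> P tv (int l) n"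
abbreviation P2 where "P2 n \<equiv> P tbv (- int l) n"

lemma start1: "start tv (int l)" and start2: "start tbv (- int l)"
  by (simp_all add: start_def)

text \<open>The boundary coefficients of the four polynomials are the unit vectors, so independence
  and spanning can be read off.\<close>

lemma lead_P:
  "lead (Suc n) (P1 n) = (1, 0)" "leadb (Suc n) (P1 n) = (0, 0)"
  "lead (Suc n) (P2 n) = (0, 1)" "leadb (Suc n) (P2 n) = (0, 0)"
  "lead (Suc n) (sigma0 (P1 n)) = (0, 0)" "leadb (Suc n) (sigma0 (P1 n)) = (0, 1)"
  "lead (Suc n) (sigma0 (P2 n)) = (0, 0)" "leadb (Suc n) (sigma0 (P2 n)) = (1, 0)"
  by (simp_all add: sigma0_zv lead_mult lead_quo sigma0_tv sigma0_tbv)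
     (simp_all add: lead_def leadb_def tv_def tbv_def)

lemma distinct_P: "distinct [P1 n, sigma0 (P1 n), P2 n, sigma0 (P2 n)]"
proof -
  have "x \<noteq> y" if "lead (Suc n) x \<noteq> lead (Suc n) y \<or> leadb (Suc n) x \<noteq> leadb (Suc n) y" for x y
    using that by auto
  note * = this
  show ?thesis
    by (simp; intro conjI; rule *; simp add: lead_P)
qed

lemma independent_P: "pspace.independent {P1 n, sigma0 (P1 n), P2 n, sigma0 (P2 n)}"
proof -
  have "\<forall>v\<in>{P1 n, sigma0 (P1 n), P2 n, sigma0 (P2 n)}. u v = 0"
    if "(\<Sum>v\<in>{P1 n, sigma0 (P1 n), P2 n, sigma0 (P2 n)}. pscale (u v) v) = 0" for u
  proof -
    let ?x = "pscale (u (P1 n)) (P1 n) + (pscale (u (sigma0 (P1 n))) (sigma0 (P1 n))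
      + (pscale (u (P2 n)) (P2 n) + pscale (u (sigma0 (P2 n))) (sigma0 (P2 n))))"
    have "?x = 0"
      using that distinct_P[of n] by (simp add: add.assoc)
    then have "lead (Suc n) ?x = (0, 0)" "leadb (Suc n) ?x = (0, 0)"
      by (simp_all only:) (simp_all add: lead_def leadb_def)
    then show ?thesis
      unfolding lead_linear lead_P by simp
  qed
  then show ?thesis
    by (subst pspace.dependent_finite) auto
qed

lemma span_P: "pspace.span {P1 n, sigma0 (P1 n), P2 n, sigma0 (P2 n)} = harmonics m l \<kappa> (Suc n)"
proof
  show "pspace.span {P1 n, sigma0 (P1 n), P2 n, sigma0 (P2 n)} \<subseteq> harmonics m l \<kappa> (Suc n)"
    using P_harmonic[OF start1] P_harmonic[OF start2]
    by (intro pspace.span_minimal subspace_harmonics) auto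
  show "harmonics m l \<kappa> (Suc n) \<subseteq> pspace.span {P1 n, sigma0 (P1 n), P2 n, sigma0 (P2 n)}"
  proof
    fix f assume f: "f \<in> harmonics m l \<kappa> (Suc n)"
    \<comment> \<open>The combination with the same boundary coefficients as \<open>f\<close>. The
      components of \<open>leadb\<close> are crossed because \<open>sigma0\<close> swaps
      \<open>t\<close> and \<open>t'\<close>.\<close>
    define g where "g = pscale (fst (lead (Suc n) f)) (P1 n) + pscale (snd (lead (Suc n) f)) (P2 n)
      + pscale (snd (leadb (Suc n) f)) (sigma0 (P1 n)) + pscale (fst (leadb (Suc n) f)) (sigma0 (P2 n))"
    have g: "g \<in> pspace.span {P1 n, sigma0 (P1 n), P2 n, sigma0 (P2 n)}"
      unfolding g_def by (intro pspace.span_add pspace.span_scale pspace.span_base) auto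
    have "g \<in> harmonics m l \<kappa> (Suc n)"
      unfolding g_def
      by (intro pspace.subspace_add[OF subspace_harmonics] pspace.subspace_scale[OF subspace_harmonics]
          P_harmonic start1 start2)
    then have "f - g \<in> harmonics m l \<kappa> (Suc n)"
      by (rule pspace.subspace_diff[OF subspace_harmonics f])
    moreover have "lead (Suc n) (f - g) = (0, 0)" "leadb (Suc n) (f - g) = (0, 0)"
      unfolding g_def lead_linear lead_P by (simp_all add: prod_eq_iff)
    ultimately have "f - g = 0"
      by (intro harmonic_eq_0I[of "f - g" "Suc n"]) (simp_all add: lead_def leadb_def)
    then show "f \<in> pspace.span {P1 n, sigma0 (P1 n), P2 n, sigma0 (P2 n)}"
      using g by simp
  qed
qed

section \<open>Orthogonality relations, and norms as Pochhammer quotients\<close>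

lemma ip_span_eq_0:
  assumes "\<And>a b. a \<in> A \<Longrightarrow> b \<in> B \<Longrightarrow> ip a b = 0" "u \<in> pspace.span A" "v \<in> pspace.span B"
  shows "ip u v = 0"
proof -
  have z: "ip 0 x = 0" "ip x 0 = 0" for x
    using ip_pscale_left[of 0 0 x] ip_pscale_right[of x 0 0] by (simp_all add: pscale_0)
  have 1: "ip a v = 0" if "a \<in> A" for a
    using assms(3)
  proof (rule pspace.span_induct)
    show "pspace.subspace {v. ip a v = 0}"
      by (rule pspace.subspaceI) (simp_all add: ip_simps z)
  qed (use that assms(1) in auto)
  show ?thesis
    using assms(2)
  proof (rule pspace.span_induct)
    show "pspace.subspace {u. ip u v = 0}"
      by (rule pspace.subspaceI) (simp_all add: ip_simps z)
  qed (use 1 in auto)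
qed

lemma orthogonal_spans:
  assumes "u \<in> pspace.span {P1 n, sigma0 (P1 n)}" "v \<in> pspace.span {P2 n, sigma0 (P2 n)}"
  shows "ip u v = 0"
  by (rule ip_span_eq_0[OF _ assms]) (auto simp: ip_zv_quo[OF start2] quo_orth)

lemma ip_P_sigma0:
  assumes "start e w" "\<not> int m dvd w + int (Suc n)"
  shows "ip (P e w n) (sigma0 (P e w n)) = 0"
  using assms by (simp add: ip_zv_quo(2)[OF assms(1)] mk_def)

text \<open>The indices where the recursion is twisted are \<open>i = m (\<lambda> + r)\<close> with \<open>r \<ge> 0\<close>.\<close>

lemma sqnorm_eq:
  fixes i0 K :: nat and lam :: real
  assumes i0: "0 < i0" "i0 < m" "int m dvd w + int i0" and lam: "lam = real i0 / real m"
    and n: "Suc n = i0 + m * K"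
  shows "sqnorm w n = 2 ^ Suc n * fact n *
    (pochhammer (lam - \<kappa>) K * pochhammer (lam + \<kappa>) K / (pochhammer lam K)\<^sup>2)"
proof -
  \<comment> \<open>The value \<open>r = K\<close> would give \<open>Suc n\<close>, which is twisted
    but lies just outside the range.\<close>
  have "{i\<in>{1..n}. int m dvd w + int i} = (\<lambda>r. i0 + m * r) ` {0..<K}"
  proof (intro equalityI subsetI)
    fix i assume i: "i \<in> {i\<in>{1..n}. int m dvd w + int i}"
    then have "int m dvd (w + int i) - (w + int i0)"
      using i0 by (intro dvd_diff) auto
    then have d: "int m dvd int i - int i0" by simp
    \<comment> \<open>Otherwise \<open>m\<close> would divide a number strictly between
      \<open>0\<close> and \<open>m\<close>.\<close>
    have ge: "i0 \<le> i"
    proof (rule ccontr)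
      assume "\<not> i0 \<le> i"
      then have "int m dvd int i0 - int i" "0 < int i0 - int i"
        using d dvd_minus_iff[of "int m" "int i - int i0"] by simp_all
      then have "int m \<le> int i0 - int i" by (rule zdvd_imp_le)
      then show False using i0 by simp
    qed
    then have "m dvd i - i0"
      using d by (metis int_dvd_int_iff of_nat_diff)
    then obtain r where r: "i - i0 = m * r" by (auto simp: dvd_def)
    then have ir: "i = i0 + m * r" using ge by simp
    moreover have "i \<le> n" using i by simp
    ultimately have "m * r < m * K" using n by linarith
    then have "r < K" by simp
    then show "i \<in> (\<lambda>r. i0 + m * r) ` {0..<K}" using ir by auto
  next
    fix i assume "i \<in> (\<lambda>r. i0 + m * r) ` {0..<K}"
    then obtain r where r: "r < K" "i = i0 + m * r" by auto
    have "i0 + m * r < i0 + m * K" using r m by simp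
    then have "i \<le> n" using n r by linarith
    moreover have "int m dvd (w + int i0) + int m * int r" using i0 by simp
    ultimately show "i \<in> {i\<in>{1..n}. int m dvd w + int i}"
      using r i0 by (simp add: add.assoc)
  qed
  then have "(\<Prod>i\<in>{i\<in>{1..n}. int m dvd w + int i}. 1 - (real m * \<kappa> / real i)\<^sup>2)
    = (\<Prod>r\<in>{0..<K}. 1 - (real m * \<kappa> / real (i0 + m * r))\<^sup>2)"
    using m by (simp add: prod.reindex inj_on_def)
  also have "\<dots> = (\<Prod>r\<in>{0..<K}. (lam - \<kappa> + real r) * (lam + \<kappa> + real r) / (lam + real r)\<^sup>2)"
  proof (rule prod.cong)
    fix r assume "r \<in> {0..<K}"
    have pos: "lam + real r > 0"
      using i0 m by (auto simp: lam intro!: add_pos_nonneg)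
    \<comment> \<open>Dividing by \<open>m\<close> turns the factor into
      \<open>1 - (\<kappa> / (lam + r))^2\<close>, a difference of squares.\<close>
    have "real (i0 + m * r) = real m * (lam + real r)"
      using m by (simp add: lam field_simps)
    then have e: "real m * \<kappa> / real (i0 + m * r) = \<kappa> / (lam + real r)"
      using m by simp
    show "1 - (real m * \<kappa> / real (i0 + m * r))\<^sup>2
        = (lam - \<kappa> + real r) * (lam + \<kappa> + real r) / (lam + real r)\<^sup>2"
      unfolding e using pos
      by (simp add: power_divide eq_divide_eq left_diff_distrib) (simp add: power2_eq_square algebra_simps)
  qed simp
  also have "\<dots> = pochhammer (lam - \<kappa>) K * pochhammer (lam + \<kappa>) K / (pochhammer lam K)\<^sup>2"
    by (simp add: pochhammer_prod prod_dividef prod.distrib prod_power_distrib)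
  finally show ?thesis by (simp add: sqnorm_def)
qed

text \<open>With \<open>A\<close> the norm of \<open>p\<close> and
  \<open>c = \<kappa> / (lam + K)\<close>, the Gram matrix of \<open>p\<close> and \<open>s\<close>
  has diagonal entries \<open>A\<close> and off-diagonal entries \<open>- c A\<close>. So
  \<open>p + s\<close>, \<open>p - s\<close> and \<open>f = p + c s\<close> have norms
  \<open>2 A (1 - c)\<close>, \<open>2 A (1 + c)\<close> and \<open>A (1 - c^2)\<close>; the factors
  \<open>1 - c\<close> and \<open>1 + c\<close> extend the Pochhammer symbols by one term.\<close>

lemma norms:
  fixes i0 K :: nat and lam :: real
  assumes st: "start e w" and i0: "0 < i0" "i0 < m" "int m dvd w + int i0"
    and lam: "lam = real i0 / real m" and n: "Suc n = i0 + m * K"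
  defines "p \<equiv> P e w n"
  defines "s \<equiv> sigma0 p"
  defines "f \<equiv> p + pscale (of_real (real m * \<kappa> / real (Suc n))) s"
  shows "ip (p + s) (p - s) = 0"
    and "ip (p + s) (p + s) = of_real (2 ^ (Suc n + 2) * fact (Suc n) *
      (pochhammer (lam - \<kappa>) (Suc K) * pochhammer (lam + \<kappa>) K)
      / (pochhammer lam (Suc K) * pochhammer lam K))"
    and "ip (p - s) (p - s) = of_real (2 ^ (Suc n + 2) * fact (Suc n) *
      (pochhammer (lam - \<kappa>) K * pochhammer (lam + \<kappa>) (Suc K))
      / (pochhammer lam K * pochhammer lam (Suc K)))"
    and "ip s f = 0"
    and "ip f f = of_real (2 ^ (Suc n + 1) * fact (Suc n) *
      (pochhammer (lam - \<kappa>) (Suc K) * pochhammer (lam + \<kappa>) (Suc K))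
      / (pochhammer lam (Suc K))\<^sup>2)"
proof -
  define c where "c = real m * \<kappa> / real (Suc n)"
  define A where "A = 2 ^ (Suc n + 1) * fact (Suc n) *
    (pochhammer (lam - \<kappa>) K * pochhammer (lam + \<kappa>) K / (pochhammer lam K)\<^sup>2)"
  have lampos: "lam > 0" using i0 m by (simp add: lam)
  have A: "A = 2 * real (Suc n) * sqnorm w n"
    unfolding A_def sqnorm_eq[OF i0 lam n] by simp
  have dvd: "int m dvd w + int (Suc n)"
    using i0(3) dvd_add[of "int m" "w + int i0" "int m * int K"] by (simp add: n add.assoc)
  have mk: "mk w n = of_real c * of_nat (Suc n)"
    using dvd by (simp add: mk_def c_def del: of_nat_Suc)
  have ips: "ip p p = of_real A" "ip s s = of_real A" "ip p s = of_real (- c * A)" "ip s p = of_real (- c * A)"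
    unfolding p_def s_def ip_zv_quo[OF st] mk A using ip_quo[OF st, of n] by simp_all
  have diff: "p - s = p + pscale (- 1) s"
    by (simp add: pscale_uminus pscale_1)
  have c: "c = \<kappa> / (lam + real K)"
  proof -
    have "real (Suc n) = real m * (lam + real K)"
      unfolding n using m by (simp add: lam field_simps)
    then show ?thesis using m by (simp add: c_def)
  qed
  have lK: "lam + real K > 0" using lampos by simp
  have c1: "1 - c = (lam - \<kappa> + real K) / (lam + real K)" "1 + c = (lam + \<kappa> + real K) / (lam + real K)"
    using lK by (simp_all add: c field_simps)
  have ph: "pochhammer lam K \<noteq> 0" using pochhammer_pos[OF lampos, of K] by simp
  show "ip (p + s) (p - s) = 0"
    unfolding diff ip_simps ips by simp
  have "ip (p + s) (p + s) = of_real (2 * A * (1 - c))"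
    unfolding ip_simps ips by (simp add: algebra_simps)
  also have "2 * A * (1 - c) = 2 ^ (Suc n + 2) * fact (Suc n) *
      (pochhammer (lam - \<kappa>) (Suc K) * pochhammer (lam + \<kappa>) K)
      / (pochhammer lam (Suc K) * pochhammer lam K)"
    unfolding c1 A_def pochhammer_Suc by (simp add: field_simps power2_eq_square)
  finally show "ip (p + s) (p + s) = of_real \<dots>" .
  have "ip (p - s) (p - s) = of_real (2 * A * (1 + c))"
    unfolding diff ip_simps ips by (simp add: algebra_simps)
  also have "2 * A * (1 + c) = 2 ^ (Suc n + 2) * fact (Suc n) *
      (pochhammer (lam - \<kappa>) K * pochhammer (lam + \<kappa>) (Suc K))
      / (pochhammer lam K * pochhammer lam (Suc K))"
    unfolding c1 A_def pochhammer_Suc by (simp add: field_simps power2_eq_square)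
  finally show "ip (p - s) (p - s) = of_real \<dots>" .
  show "ip s f = 0"
    unfolding f_def c_def[symmetric] ip_simps ips by simp
  have "ip f f = of_real (A * ((1 - c) * (1 + c)))"
    unfolding f_def c_def[symmetric] ip_simps ips by (simp add: algebra_simps)
  also have "A * ((1 - c) * (1 + c)) = 2 ^ (Suc n + 1) * fact (Suc n) *
      (pochhammer (lam - \<kappa>) (Suc K) * pochhammer (lam + \<kappa>) (Suc K))
      / (pochhammer lam (Suc K))\<^sup>2"
    unfolding c1 A_def pochhammer_Suc by (simp add: field_simps power2_eq_square)
  finally show "ip f f = of_real \<dots>" .
qed

end

section \<open>Translation to the indexing by \<open>n\<close>, \<open>k\<close> and
  \<open>j\<close>\<close>

theorem mainTheorem3:
  fixes m l :: nat and \<kappa> :: real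
    and p :: "nat \<Rightarrow> nat \<Rightarrow> pspace" and lam :: "nat \<Rightarrow> real"
  assumes m: "m \<ge> 3" and l: "1 \<le> l" "l \<le> (m - 1) div 2"
    and p1: "p 1 = pol1 m l \<kappa>" and p2: "p 2 = pol2 m l \<kappa>"
    and lam1: "lam 1 = (real m - real l) / real m" and lam2: "lam 2 = real l / real m"
  shows "(\<forall>n\<ge>1.
            distinct [p 1 n, sigma0 (p 1 n), p 2 n, sigma0 (p 2 n)]
          \<and> pspace.independent {p 1 n, sigma0 (p 1 n), p 2 n, sigma0 (p 2 n)}
          \<and> pspace.span {p 1 n, sigma0 (p 1 n), p 2 n, sigma0 (p 2 n)} = harmonics m l \<kappa> n
          \<and> (\<forall>u \<in> pspace.span {p 1 n, sigma0 (p 1 n)}.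
               \<forall>v \<in> pspace.span {p 2 n, sigma0 (p 2 n)}. form m l \<kappa> u v = 0)
          \<and> (\<not> [int n + int l = 0] (mod int m) \<longrightarrow> form m l \<kappa> (p 1 n) (sigma0 (p 1 n)) = 0)
          \<and> (\<not> [int n - int l = 0] (mod int m) \<longrightarrow> form m l \<kappa> (p 2 n) (sigma0 (p 2 n)) = 0))
       \<and> (\<forall>(k::int) (j::nat) (n::nat).
            k \<ge> -1 \<and>
            (j = 1 \<and> int n = int m * (k + 2) - int l \<or> j = 2 \<and> int n = int m * (k + 1) + int l) \<longrightarrow>
            (let P = p j n; S = sigma0 (p j n);
                 F = P + pscale (of_real (real m * \<kappa> / real n)) S;
                 k1 = nat (k + 1); k2 = nat (k + 2)
             in form m l \<kappa> (P + S) (P - S) = 0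
              \<and> form m l \<kappa> (P + S) (P + S) = of_real (2 ^ (n + 2) * fact n *
                  (pochhammer (lam j - \<kappa>) k2 * pochhammer (lam j + \<kappa>) k1)
                  / (pochhammer (lam j) k2 * pochhammer (lam j) k1))
              \<and> form m l \<kappa> (P - S) (P - S) = of_real (2 ^ (n + 2) * fact n *
                  (pochhammer (lam j - \<kappa>) k1 * pochhammer (lam j + \<kappa>) k2)
                  / (pochhammer (lam j) k1 * pochhammer (lam j) k2))
              \<and> form m l \<kappa> S F = 0
              \<and> form m l \<kappa> F F = of_real (2 ^ (n + 1) * fact n *
                  (pochhammer (lam j - \<kappa>) k2 * pochhammer (lam j + \<kappa>) k2)
                  / (pochhammer (lam j) k2)\<^sup>2)))"
proof (intro conjI allI impI)
  have "l < m" "0 < l" using m l by auto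
  then interpret dihedral m l \<kappa>
    by unfold_locales (auto dest: dvd_imp_le)
  have p1_Suc: "p 1 (Suc n) = P1 n" and p2_Suc: "p 2 (Suc n) = P2 n" for n
    by (simp_all only: p1 p2 pol1_Suc pol2_Suc)
  fix n :: nat assume "1 \<le> n"
  then obtain k where n: "n = Suc k" by (cases n) auto
  show "distinct [p 1 n, sigma0 (p 1 n), p 2 n, sigma0 (p 2 n)]"
    unfolding n p1_Suc p2_Suc by (rule distinct_P)
  show "pspace.independent {p 1 n, sigma0 (p 1 n), p 2 n, sigma0 (p 2 n)}"
    unfolding n p1_Suc p2_Suc by (rule independent_P)
  show "pspace.span {p 1 n, sigma0 (p 1 n), p 2 n, sigma0 (p 2 n)} = harmonics m l \<kappa> n"
    unfolding n p1_Suc p2_Suc by (rule span_P)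
  show "\<forall>u\<in>pspace.span {p 1 n, sigma0 (p 1 n)}. \<forall>v\<in>pspace.span {p 2 n, sigma0 (p 2 n)}. ip u v = 0"
    unfolding n p1_Suc p2_Suc using orthogonal_spans by blast
  show "ip (p 1 n) (sigma0 (p 1 n)) = 0" if "\<not> [int n + int l = 0] (mod int m)"
    unfolding n p1_Suc using that n by (intro ip_P_sigma0 start1) (simp add: cong_0_iff ac_simps)
  show "ip (p 2 n) (sigma0 (p 2 n)) = 0" if "\<not> [int n - int l = 0] (mod int m)"
    unfolding n p2_Suc using that n by (intro ip_P_sigma0 start2) (simp add: cong_0_iff)
next
  have lm: "l < m" "0 < l" using m l by auto
  then interpret dihedral m l \<kappa>
    by unfold_locales (auto dest: dvd_imp_le)
  have p1_Suc: "p 1 (Suc n) = P1 n" and p2_Suc: "p 2 (Suc n) = P2 n" for n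
    by (simp_all only: p1 p2 pol1_Suc pol2_Suc)
  fix k :: int and j n :: nat
  assume *: "- 1 \<le> k \<and>
    (j = 1 \<and> int n = int m * (k + 2) - int l \<or> j = 2 \<and> int n = int m * (k + 1) + int l)"
  \<comment> \<open>As \<open>k \<ge> -1\<close>, this is \<open>k + 1\<close> as a natural number;
    the two Pochhammer lengths are \<open>K\<close> and \<open>Suc K\<close>.\<close>
  define K where "K = nat (k + 1)"
  have K: "k = int K - 1" and k2: "nat (k + 2) = Suc K"
    using * by (auto simp: K_def)
  \<comment> \<open>The least twisted index \<open>i0\<close> is \<open>m - l\<close> for
    \<open>j = 1\<close> and \<open>l\<close> for \<open>j = 2\<close>; in both cases
    \<open>n = i0 + m K\<close>, since \<open>m (k + 2) - l = (m - l) + m (k + 1)\<close>.\<close>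
  obtain e w i0 n' where st: "start e w" and i0: "0 < i0" "i0 < m" "int m dvd w + int i0"
    and lam: "lam j = real i0 / real m" and n: "n = Suc n'" "Suc n' = i0 + m * K"
    and p: "p j n = P e w n'"
  proof -
    consider "j = 1" "int n = int m * (k + 2) - int l" | "j = 2" "int n = int m * (k + 1) + int l"
      using * by blast
    then show ?thesis
    proof cases
      case 1
      have "int n = int (m - l + m * K)"
        using 1(2) lm by (simp add: K algebra_simps)
      then have n: "n = m - l + m * K" by (simp only: of_nat_eq_iff)
      then have "n \<noteq> 0" using lm by simp
      then obtain n' where n': "n = Suc n'" using not0_implies_Suc by blast
      have "p j n = P1 n'" unfolding 1(1) n' by (rule p1_Suc)
      then show ?thesis
        using lm lam1 1 n n' by (intro that[of tv "int l" "m - l" n'] start1) (auto simp: of_nat_diff)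
    next
      case 2
      have "int n = int (l + m * K)"
        using 2(2) by (simp add: K)
      then have n: "n = l + m * K" by (simp only: of_nat_eq_iff)
      then have "n \<noteq> 0" using lm by simp
      then obtain n' where n': "n = Suc n'" using not0_implies_Suc by blast
      have "p j n = P2 n'" unfolding 2(1) n' by (rule p2_Suc)
      then show ?thesis
        using lm lam2 2 n n' by (intro that[of tbv "- int l" l n'] start2) auto
    qed
  qed
  show "let P = p j n; S = sigma0 (p j n);
                 F = P + pscale (of_real (real m * \<kappa> / real n)) S;
                 k1 = nat (k + 1); k2 = nat (k + 2)
             in form m l \<kappa> (P + S) (P - S) = 0
              \<and> form m l \<kappa> (P + S) (P + S) = of_real (2 ^ (n + 2) * fact n *
                  (pochhammer (lam j - \<kappa>) k2 * pochhammer (lam j + \<kappa>) k1)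
                  / (pochhammer (lam j) k2 * pochhammer (lam j) k1))
              \<and> form m l \<kappa> (P - S) (P - S) = of_real (2 ^ (n + 2) * fact n *
                  (pochhammer (lam j - \<kappa>) k1 * pochhammer (lam j + \<kappa>) k2)
                  / (pochhammer (lam j) k1 * pochhammer (lam j) k2))
              \<and> form m l \<kappa> S F = 0
              \<and> form m l \<kappa> F F = of_real (2 ^ (n + 1) * fact n *
                  (pochhammer (lam j - \<kappa>) k2 * pochhammer (lam j + \<kappa>) k2)
                  / (pochhammer (lam j) k2)\<^sup>2)"
    unfolding Let_def k2 K_def[symmetric] p unfolding n(1)
    by (intro conjI norms[OF st i0 lam n(2)])
qed

end
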